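(* Let $A \in L^{\$}(l^2(\mathbb{Z}^+))$ be an operator for which the finite sections sequence $(P_n A P_n)_{n\ge 1}$ is stable. Then for every limit operator $A_h \in \sigma_+(A)$ one has $P_1 (JQA_hQJ)^{-1} P_1 \neq 0$ (where $JQA_hQJ$ is regarded as an operator on $l^2(\mathbb{Z}^+)$, which is invertible under the stability hypothesis, and $P_1 (JQA_hQJ)^{-1} P_1$ is identified with the complex number that is the $(0,0)$ entry of $(JQA_hQJ)^{-1}$), and $$\omega(A) = \{ G[A_h] : A_h \in \sigma_+(A) \}, \qquad G[A_h] := \frac{1}{P_1 (JQA_hQJ)^{-1} P_1}.$$
   Context: $\mathbb{Z}^+$ denotes the non-negative integers. For $\mathbb{I} \subseteq \mathbb{Z}$, $l^2(\mathbb{I})$ is regarded as a closed subspace of $l^2(\mathbb{Z})$ and $P_{\mathbb{I}}$ is the orthogonal projection of $l^2(\mathbb{Z})$ onto $l^2(\mathbb{I})$. Put $P := P_{\mathbb{Z}^+}$, $Q := I - P$, $P_n := P_{\{0,1,\dots,n-1\}}$. $L(H)$ is the algebra of bounded linear operators on $H$. The shift $U_k$ ($k\in\mathbb{Z}$) on $l^2(\mathbb{Z})$ is $(U_k x)_n = x_{n-k}$, and the flip $J$ on $l^2(\mathbb{Z})$ is $(Jx)_m := x_{-m-1}$. Limit operators: let $h : \mathbb{N} \to \mathbb{Z}$ be a sequence with $|h(n)| \to \infty$. An operator $A_h \in L(l^2(\mathbb{Z}))$ is the limit operator of $A \in L(l^2(\mathbb{Z}))$ with respect to $h$ if $U_{-h(n)}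 A U_{h(n)} \to A_h$ $^*$-strongly (i.e. the sequence converges strongly to $A_h$ and the sequence of adjoints converges strongly to $A_h^*$). $L^{\$}(l^2(\mathbb{Z}))$ is the set of all $A \in L(l^2(\mathbb{Z}))$ such that every sequence $h$ with $|h(n)| \to \infty$ has a subsequence $g$ for which the limit operator $A_g$ exists. $\sigma_+(A)$ is the set of all limit operators of $A$ with respect to sequences $h$ tending to $+\infty$. An operator $A \in L(l^2(\mathbb{Z}^+))$ is identified with the operator $PAP+Q$ on $l^2(\mathbb{Z})$: $A \in L^{\$}(l^2(\mathbb{Z}^+))$ means $PAP+Q \in L^{\$}(l^2(\mathbb{Z}))$, and $\sigma_+(A) := \sigma_+(PAP+Q)$. The sequence $(P_nAP_n)$, each $P_nAP_n$ regarded as an operator (an $n\times n$ matrix) on $\operatorname{im} P_n$, is stable if the matrices $P_nAP_n$ are invertible for all sufficiently large $n$ and the norms of their inverses are uniformly bounded. If it is stable, $\omega(A)$ denotes the set of all partial limits (limits of subsequences) of the sequence $$n \mapsto \frac{\det(P_nAP_n)}{\det(P_{n-1}AP_{n-1})},$$ which is defined for all sufficiently large $n$. *)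

theory Defs
  imports "HOL-Analysis.Inner_Product" "HOL-Analysis.Infinite_Sum" "Jordan_Normal_Form.Determinant"
begin

section \<open>The Hilbert space of square-summable two-sided sequences\<close>

lemma cmod_add_sq_le: "(cmod (a + b))\<^sup>2 \<le> 2 * (cmod a)\<^sup>2 + 2 * (cmod b)\<^sup>2"
proof -
  have "(cmod (a + b))\<^sup>2 \<le> (cmod a + cmod b)\<^sup>2"
    by (simp add: norm_triangle_ineq power_mono)
  also have "\<dots> \<le> 2 * (cmod a)\<^sup>2 + 2 * (cmod b)\<^sup>2"
    using sum_squares_bound[of "cmod a" "cmod b"] by (simp add: power2_sum)
  finally show ?thesis .
qed

lemma summable_on_dominated:
  fixes f g :: "'a \<Rightarrow> real"
  assumes "g summable_on A" "\<And>k. k \<in> A \<Longrightarrow> 0 \<le> f k" "\<And>k. k \<in> A \<Longrightarrow> f k \<le> g k"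
  shows "f summable_on A"
  using summable_on_comparison_test[OF assms(1), of f] assms(2,3) by simp

typedef ell2 = "{x :: int \<Rightarrow> complex. (\<lambda>k. (cmod (x k))\<^sup>2) summable_on UNIV}"
  morphisms coord Abs_ell2
  by (rule exI[of _ "\<lambda>_. 0"]) simp

setup_lifting type_definition_ell2

lemma summable_coord: "(\<lambda>k. (cmod (coord x k))\<^sup>2) summable_on UNIV"
  using coord[of x] by simp

lemma ell2_eqI: "(\<And>k. coord x k = coord y k) \<Longrightarrow> x = y"
  by (simp add: coord_inject[symmetric] fun_eq_iff)

lemma summable_coord_prod:
  "(\<lambda>k. cmod (coord x k) * cmod (coord y k)) summable_on UNIV"
proof (rule summable_on_dominated)
  show "(\<lambda>k. (cmod (coord x k))\<^sup>2 + (cmod (coord y k))\<^sup>2) summable_on UNIV"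
    by (intro summable_on_add summable_coord)
  show "cmod (coord x k) * cmod (coord y k) \<le> (cmod (coord x k))\<^sup>2 + (cmod (coord y k))\<^sup>2" for k
  proof -
    have "0 \<le> cmod (coord x k) * cmod (coord y k)" by simp
    with sum_squares_bound[of "cmod (coord x k)" "cmod (coord y k)"] show ?thesis
      unfolding mult.assoc by linarith
  qed
qed simp

lemma summable_coord_inner: "(\<lambda>k. inner (coord x k) (coord y k)) summable_on UNIV"
proof (rule abs_summable_summable, rule summable_on_dominated)
  show "(\<lambda>k. cmod (coord x k) * cmod (coord y k)) summable_on UNIV"
    by (rule summable_coord_prod)
qed (simp_all add: Cauchy_Schwarz_ineq2)

lift_definition scaleC_ell2 :: "complex \<Rightarrow> ell2 \<Rightarrow> ell2" is "\<lambda>c x k. c * x k"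
  by (simp add: norm_mult power_mult_distrib summable_on_cmult_right)

instantiation ell2 :: real_inner
begin

lift_definition zero_ell2 :: ell2 is "\<lambda>_. 0" by simp

lift_definition plus_ell2 :: "ell2 \<Rightarrow> ell2 \<Rightarrow> ell2" is "\<lambda>x y k. x k + y k"
proof -
  fix x y :: "int \<Rightarrow> complex"
  assume "(\<lambda>k. (cmod (x k))\<^sup>2) summable_on UNIV" "(\<lambda>k. (cmod (y k))\<^sup>2) summable_on UNIV"
  then have "(\<lambda>k. 2 * (cmod (x k))\<^sup>2 + 2 * (cmod (y k))\<^sup>2) summable_on UNIV"
    by (intro summable_on_add summable_on_cmult_right) auto
  then show "(\<lambda>k. (cmod (x k + y k))\<^sup>2) summable_on UNIV"
    by (auto intro: summable_on_dominated cmod_add_sq_le)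
qed

lift_definition uminus_ell2 :: "ell2 \<Rightarrow> ell2" is "\<lambda>x k. - x k" by simp

lift_definition scaleR_ell2 :: "real \<Rightarrow> ell2 \<Rightarrow> ell2" is "\<lambda>r x k. r *\<^sub>R x k"
  by (simp add: power_mult_distrib summable_on_cmult_right)

definition minus_ell2 :: "ell2 \<Rightarrow> ell2 \<Rightarrow> ell2" where "x - y = x + - y" for x y :: ell2

text \<open>\<^term>\<open>inner\<close> is the real part of the complex inner product \<open>cinner\<close> below.\<close>

definition inner_ell2 :: "ell2 \<Rightarrow> ell2 \<Rightarrow> real" where
  "inner x y = (\<Sum>\<^sub>\<infinity>k. inner (coord x k) (coord y k))" for x y :: ell2

definition norm_ell2 :: "ell2 \<Rightarrow> real" where
  "norm x = sqrt (\<Sum>\<^sub>\<infinity>k. (cmod (coord x k))\<^sup>2)" for x :: ell2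

definition sgn_ell2 :: "ell2 \<Rightarrow> ell2" where "sgn x = inverse (norm x) *\<^sub>R x" for x :: ell2

definition dist_ell2 :: "ell2 \<Rightarrow> ell2 \<Rightarrow> real" where "dist x y = norm (x - y)" for x y :: ell2

definition uniformity_ell2 :: "(ell2 \<times> ell2) filter" where
  "uniformity = (INF e\<in>{0<..}. principal {(x :: ell2, y). dist x y < e})"

definition open_ell2 :: "ell2 set \<Rightarrow> bool" where
  "open U \<longleftrightarrow> (\<forall>x\<in>U. eventually (\<lambda>(x', y). x' = x \<longrightarrow> y \<in> U) uniformity)" for U :: "ell2 set"

instance
proof
  fix x y z :: ell2 and r s :: real
  show "x + y + z = x + (y + z)" "x + y = y + x" "0 + x = x" "- x + x = 0"
    "r *\<^sub>R (x + y) = r *\<^sub>R x + r *\<^sub>R y" "(r + s) *\<^sub>R x = r *\<^sub>R x + s *\<^sub>R x"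
    "r *\<^sub>R s *\<^sub>R x = (r * s) *\<^sub>R x" "1 *\<^sub>R x = x"
    by (transfer; simp add: algebra_simps)+
  show "x - y = x + - y" by (rule minus_ell2_def)
  show "dist x y = norm (x - y)" by (rule dist_ell2_def)
  show "sgn x = inverse (norm x) *\<^sub>R x" by (rule sgn_ell2_def)
  show "uniformity = (INF e\<in>{0<..}. principal {(x :: ell2, y). dist x y < e})"
    by (rule uniformity_ell2_def)
  show "open U \<longleftrightarrow> (\<forall>x\<in>U. eventually (\<lambda>(x', y). x' = x \<longrightarrow> y \<in> U) uniformity)"
    for U :: "ell2 set"
    by (rule open_ell2_def)
  show "inner x y = inner y x" by (simp add: inner_ell2_def inner_commute)
  show "inner (x + y) z = inner x z + inner y z"
    by (simp add: inner_ell2_def plus_ell2.rep_eq inner_add_left infsum_add summable_coord_inner)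
  show "inner (r *\<^sub>R x) y = r * inner x y"
    by (simp add: inner_ell2_def scaleR_ell2.rep_eq infsum_cmult_right')
  show "0 \<le> inner x x" by (simp add: inner_ell2_def infsum_nonneg)
  show "inner x x = 0 \<longleftrightarrow> x = 0"
  proof
    assume "inner x x = 0"
    then have "inner (coord x k) (coord x k) = 0" for k
      using nonneg_infsum_le_0D[of "\<lambda>k. inner (coord x k) (coord x k)" UNIV k]
      by (simp add: inner_ell2_def summable_coord_inner)
    then show "x = 0" by (intro ell2_eqI) (simp add: zero_ell2.rep_eq)
  qed (simp add: inner_ell2_def zero_ell2.rep_eq)
  show "norm x = sqrt (inner x x)"
    by (simp add: norm_ell2_def inner_ell2_def power2_norm_eq_inner)
qed

end

definition cinner :: "ell2 \<Rightarrow> ell2 \<Rightarrow> complex" where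
  "cinner x y = (\<Sum>\<^sub>\<infinity>k. coord x k * cnj (coord y k))"

lift_definition basis_vec :: "int \<Rightarrow> ell2" is "\<lambda>j k. if k = j then 1 else 0"
proof -
  fix j :: int
  have "(\<lambda>k. (cmod (if k = j then 1 else 0))\<^sup>2) summable_on {j}" by simp
  then show "(\<lambda>k. (cmod (if k = j then 1 else 0))\<^sup>2) summable_on UNIV"
    by (rule summable_on_cong_neutral[THEN iffD1, rotated -1]) auto
qed


section \<open>Subspaces, projections, shifts and the flip\<close>

definition ell2_on :: "int set \<Rightarrow> ell2 set" where
  "ell2_on I = {x. \<forall>k. k \<notin> I \<longrightarrow> coord x k = 0}"

lift_definition proj_on :: "int set \<Rightarrow> ell2 \<Rightarrow> ell2" is "\<lambda>I x k. if k \<in> I then x k else 0"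
  by (erule summable_on_dominated) auto

abbreviation Zplus :: "int set" where "Zplus \<equiv> {0..}"

definition P :: "ell2 \<Rightarrow> ell2" where "P = proj_on Zplus"

definition Q :: "ell2 \<Rightarrow> ell2" where "Q x = x - P x"

definition Pn :: "nat \<Rightarrow> ell2 \<Rightarrow> ell2" where "Pn n = proj_on {0..<int n}"

lift_definition shift :: "int \<Rightarrow> ell2 \<Rightarrow> ell2" is "\<lambda>j x k. x (k - j)"
proof -
  fix j :: int and x :: "int \<Rightarrow> complex"
  assume "(\<lambda>k. (cmod (x k))\<^sup>2) summable_on UNIV"
  moreover have "bij (\<lambda>k. k - j)"
    by (rule bij_betw_byWitness[of _ "\<lambda>k. k + j"]) auto
  ultimately show "(\<lambda>k. (cmod (x (k - j)))\<^sup>2) summable_on UNIV"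
    using summable_on_reindex_bij_betw[of "\<lambda>k. k - j" UNIV UNIV "\<lambda>k. (cmod (x k))\<^sup>2"] by simp
qed

lift_definition flip :: "ell2 \<Rightarrow> ell2" is "\<lambda>x k. x (- k - 1)"
proof -
  fix x :: "int \<Rightarrow> complex"
  assume "(\<lambda>k. (cmod (x k))\<^sup>2) summable_on UNIV"
  moreover have "bij (\<lambda>k :: int. - k - 1)"
    by (rule bij_betw_byWitness[of _ "\<lambda>k. - k - 1"]) auto
  ultimately show "(\<lambda>k. (cmod (x (- k - 1)))\<^sup>2) summable_on UNIV"
    using summable_on_reindex_bij_betw[of "\<lambda>k. - k - 1" UNIV UNIV "\<lambda>k. (cmod (x k))\<^sup>2"] by simp
qed


section \<open>Bounded operators\<close>

text \<open>
  An operator on the subspace \<^term>\<open>ell2_on I\<close> is a function on \<^typ>\<open>ell2\<close> of which only the values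
  on \<^term>\<open>ell2_on I\<close> matter. For \<^term>\<open>I = UNIV\<close> functions and operators coincide.
\<close>

definition bounded_ops :: "int set \<Rightarrow> (ell2 \<Rightarrow> ell2) set" where
  "bounded_ops I = {T. (\<forall>x\<in>ell2_on I. T x \<in> ell2_on I)
     \<and> (\<forall>x\<in>ell2_on I. \<forall>y\<in>ell2_on I. T (x + y) = T x + T y)
     \<and> (\<forall>c. \<forall>x\<in>ell2_on I. T (scaleC_ell2 c x) = scaleC_ell2 c (T x))
     \<and> (\<exists>K. \<forall>x\<in>ell2_on I. norm (T x) \<le> K * norm x)}"

definition invertible_on :: "int set \<Rightarrow> (ell2 \<Rightarrow> ell2) \<Rightarrow> bool" where
  "invertible_on I T \<longleftrightarrow> T \<in> bounded_ops I
     \<and> (\<exists>S\<in>bounded_ops I. \<forall>x\<in>ell2_on I. S (T x) = x \<and> T (S x) = x)"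

definition inverse_on :: "int set \<Rightarrow> (ell2 \<Rightarrow> ell2) \<Rightarrow> ell2 \<Rightarrow> ell2" where
  "inverse_on I T = inv_into (ell2_on I) T"

text \<open>For bounded \<open>T\<close> the description below has exactly one solution, the Hilbert space adjoint.\<close>

definition adj :: "(ell2 \<Rightarrow> ell2) \<Rightarrow> ell2 \<Rightarrow> ell2" where
  "adj T = (THE S. S \<in> bounded_ops UNIV \<and> (\<forall>x y. cinner (T x) y = cinner x (S y)))"


section \<open>Limit operators\<close>

definition is_limit_op :: "(ell2 \<Rightarrow> ell2) \<Rightarrow> (nat \<Rightarrow> int) \<Rightarrow> (ell2 \<Rightarrow> ell2) \<Rightarrow> bool" where
  "is_limit_op A h B \<longleftrightarrow> B \<in> bounded_ops UNIV
     \<and> (\<forall>x. (\<lambda>n. (shift (- h n) \<circ> A \<circ> shift (h n)) x) \<longlonglongrightarrow> B x)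
     \<and> (\<forall>x. (\<lambda>n. adj (shift (- h n) \<circ> A \<circ> shift (h n)) x) \<longlonglongrightarrow> adj B x)"

definition L_dollar :: "(ell2 \<Rightarrow> ell2) set" where
  "L_dollar = {A \<in> bounded_ops UNIV. \<forall>h :: nat \<Rightarrow> int.
     filterlim (\<lambda>n. \<bar>h n\<bar>) at_top sequentially \<longrightarrow>
     (\<exists>r :: nat \<Rightarrow> nat. strict_mono r \<and> (\<exists>B. is_limit_op A (h \<circ> r) B))}"

definition sigma_plus :: "(ell2 \<Rightarrow> ell2) \<Rightarrow> (ell2 \<Rightarrow> ell2) set" where
  "sigma_plus A = {B. \<exists>h :: nat \<Rightarrow> int. filterlim h at_top sequentially \<and> is_limit_op A h B}"

definition extend_op :: "(ell2 \<Rightarrow> ell2) \<Rightarrow> ell2 \<Rightarrow> ell2" where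
  "extend_op A x = P (A (P x)) + Q x"

definition L_dollar_Zplus :: "(ell2 \<Rightarrow> ell2) set" where
  "L_dollar_Zplus = {A \<in> bounded_ops Zplus. extend_op A \<in> L_dollar}"


section \<open>Finite sections\<close>

definition stable_sections :: "(ell2 \<Rightarrow> ell2) \<Rightarrow> bool" where
  "stable_sections A \<longleftrightarrow> (\<exists>C. \<forall>\<^sub>F n in sequentially.
     invertible_on {0..<int n} (Pn n \<circ> A \<circ> Pn n) \<and>
     (\<forall>x\<in>ell2_on {0..<int n}. norm (inverse_on {0..<int n} (Pn n \<circ> A \<circ> Pn n) x) \<le> C * norm x))"

definition entry :: "(ell2 \<Rightarrow> ell2) \<Rightarrow> int \<Rightarrow> int \<Rightarrow> complex" where
  "entry T i j = coord (T (basis_vec j)) i"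

definition section_mat :: "(ell2 \<Rightarrow> ell2) \<Rightarrow> nat \<Rightarrow> complex mat" where
  "section_mat A n = Matrix.mat n n (\<lambda>(i, j). entry (Pn n \<circ> A \<circ> Pn n) (int i) (int j))"

definition det_ratio :: "(ell2 \<Rightarrow> ell2) \<Rightarrow> nat \<Rightarrow> complex" where
  "det_ratio A n = Determinant.det (section_mat A n) / Determinant.det (section_mat A (n - 1))"

text \<open>
  The finitely many \<open>n\<close> for which the quotient may be undefined do not influence the partial limits.
\<close>

definition partial_limits :: "(ell2 \<Rightarrow> ell2) \<Rightarrow> complex set" where
  "partial_limits A = {z. \<exists>r :: nat \<Rightarrow> nat. strict_mono r \<and> (\<lambda>k. det_ratio A (r k)) \<longlonglongrightarrow> z}"

definition JQBQJ :: "(ell2 \<Rightarrow> ell2) \<Rightarrow> ell2 \<Rightarrow> ell2" where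
  "JQBQJ B = flip \<circ> Q \<circ> B \<circ> Q \<circ> flip"

text \<open>\<open>P\<^sub>1 (JQBQJ)\<^sup>-\<^sup>1 P\<^sub>1\<close>, identified with a complex number.\<close>

definition inv_corner :: "(ell2 \<Rightarrow> ell2) \<Rightarrow> complex" where
  "inv_corner B = entry (Pn 1 \<circ> inverse_on Zplus (JQBQJ B) \<circ> Pn 1) 0 0"

definition G :: "(ell2 \<Rightarrow> ell2) \<Rightarrow> complex" where
  "G B = 1 / inv_corner B"

end

(* Translating the n-th section by n, i.e. conjugating with U_n, turns im P_n into
   l^2({-n..-1}). Along h -> +infinity the compressions of U_{-h(n)} A U_{h(n)} to these growing
   spaces converge *-strongly to Q A_h Q and are uniformly invertible by stability; hence Q A_h Q is
   invertible and the inverses converge strongly. By Cramer's rule det(P_{n-1}AP_{n-1}) / det(P_nAP_n)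
   is the last diagonal entry of (P_nAP_n)^{-1}, so along h it tends to P_1 (JQA_hQJ)^{-1} P_1.
   These entries are bounded away from 0 because solving (P_nAP_n) x = e_{n-1} with a small last
   coordinate would make the first n - 1 coordinates small as well, by stability of P_{n-1}AP_{n-1}. *)

theory Submission
  imports Defs "HOL-Analysis.Function_Metric" "HOL-Analysis.Topology_Euclidean_Space"
begin

section \<open>Coordinates, norms and projections\<close>

text \<open>The lower bound for the compressed operators passes to the limit at once, but it gives
  only injectivity of \<open>Q A_h Q\<close> and a bound for a possible inverse; in infinite
  dimension surjectivity is a separate matter. It comes from solving the compressed equations for a
  fixed right-hand side cut to the growing interval: stability bounds the solutions, a subsequence
  converges coordinatewise, and convergence of the adjoints carries each coordinate of the equation
  to the limit. The translated operators share one norm bound because shifts are isometries.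
  Convergence of the inverses is used on a single vector: the last basis vector of each section is
  always translated to position -1, which the flip sends to 0, and this is why a corner entry
  appears. In the set equality, a sequence \<open>h\<close> must be thinned out before it indexes a
  subsequence of the quotients. Conversely, membership in \<open>L_dollar\<close> refines the index
  sequence of a partial limit until a limit operator exists along it.\<close>

lemmas coord_simps =
  zero_ell2.rep_eq plus_ell2.rep_eq uminus_ell2.rep_eq scaleR_ell2.rep_eq scaleC_ell2.rep_eq
  proj_on.rep_eq shift.rep_eq flip.rep_eq basis_vec.rep_eq

lemma coord_diff: "coord (x - y) k = coord x k - coord y k"
  unfolding minus_ell2_def by (simp only: coord_simps) simp

lemma coord_sum: "coord (sum f F) k = (\<Sum>i\<in>F. coord (f i) k)"
  by (induction F rule: infinite_finite_induct) (simp_all add: coord_simps)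

lemma norm_ell2_sq: "(norm x)\<^sup>2 = (\<Sum>\<^sub>\<infinity>k. (cmod (coord x k))\<^sup>2)"
  by (simp add: norm_ell2_def infsum_nonneg)

lemma norm_ell2_mono:
  assumes "\<And>k. cmod (coord x k) \<le> cmod (coord y k)"
  shows "norm x \<le> norm y"
  unfolding norm_ell2_def
  by (intro real_sqrt_le_mono infsum_mono summable_coord power_mono assms) simp

lemma sum_sq_coord_le_norm: "finite F \<Longrightarrow> (\<Sum>k\<in>F. (cmod (coord x k))\<^sup>2) \<le> (norm x)\<^sup>2"
  unfolding norm_ell2_sq by (rule finite_sum_le_infsum) (auto intro: summable_coord)

lemma norm_sq_le_sums:
  assumes "\<And>F. finite F \<Longrightarrow> (\<Sum>k\<in>F. (cmod (coord x k))\<^sup>2) \<le> b"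
  shows "(norm x)\<^sup>2 \<le> b"
  unfolding norm_ell2_sq by (rule infsum_le_finite_sums) (auto intro: summable_coord assms)

lemma cmod_coord_le_norm: "cmod (coord x k) \<le> norm x"
  using sum_sq_coord_le_norm[of "{k}" x] power2_le_imp_le[OF _ norm_ge_zero, of _ x] by simp

lemma norm_proj_on_le: "norm (proj_on I x) \<le> norm x"
  by (rule norm_ell2_mono) (simp add: coord_simps)

lemma norm_scaleC: "norm (scaleC_ell2 c x) = cmod c * norm x"
  by (simp add: norm_ell2_def coord_simps norm_mult power_mult_distrib infsum_cmult_right' real_sqrt_mult)

lemma norm_shift: "norm (shift j x) = norm x"
proof -
  have "bij (\<lambda>k. k - j)"
    by (rule bij_betw_byWitness[of _ "\<lambda>k. k + j"]) auto
  then show ?thesis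
    unfolding norm_ell2_def coord_simps
    by (subst infsum_reindex_bij_betw[of "\<lambda>k. k - j" UNIV UNIV "\<lambda>k. (cmod (coord x k))\<^sup>2"]) auto
qed

lemma norm_flip: "norm (flip x) = norm x"
proof -
  have "bij (\<lambda>k :: int. - k - 1)"
    by (rule bij_betw_byWitness[of _ "\<lambda>k. - k - 1"]) auto
  then show ?thesis
    unfolding norm_ell2_def coord_simps
    by (subst infsum_reindex_bij_betw[of "\<lambda>k. - k - 1" UNIV UNIV "\<lambda>k. (cmod (coord x k))\<^sup>2"]) auto
qed

lemma norm_basis_vec: "norm (basis_vec j) = 1"
proof -
  have "(\<Sum>\<^sub>\<infinity>k. (cmod (coord (basis_vec j) k))\<^sup>2) = (\<Sum>\<^sub>\<infinity>k\<in>{j}. (cmod (coord (basis_vec j) k))\<^sup>2)"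
    by (rule infsum_cong_neutral) (auto simp: coord_simps)
  then show ?thesis by (simp add: norm_ell2_def coord_simps)
qed

section \<open>Coordinate subspaces, their projections, and approximation by finitely supported
  vectors\<close>

lemma ell2_on_UNIV [simp]: "ell2_on UNIV = UNIV"
  by (auto simp: ell2_on_def)

lemma proj_on_in_ell2_on: "proj_on I x \<in> ell2_on I"
  by (simp add: ell2_on_def coord_simps)

lemma proj_on_id: "x \<in> ell2_on I \<Longrightarrow> proj_on I x = x"
  by (rule ell2_eqI) (auto simp: ell2_on_def coord_simps)

lemma proj_on_add: "proj_on I (x + y) = proj_on I x + proj_on I y"
  by (rule ell2_eqI) (simp add: coord_simps)

lemma proj_on_diff: "proj_on I (x - y) = proj_on I x - proj_on I y"
  by (rule ell2_eqI) (simp add: coord_simps coord_diff)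

lemma proj_on_scaleC: "proj_on I (scaleC_ell2 c x) = scaleC_ell2 c (proj_on I x)"
  by (rule ell2_eqI) (simp add: coord_simps)

lemma ell2_on_add: "x \<in> ell2_on I \<Longrightarrow> y \<in> ell2_on I \<Longrightarrow> x + y \<in> ell2_on I"
  by (simp add: ell2_on_def coord_simps)

lemma ell2_on_diff: "x \<in> ell2_on I \<Longrightarrow> y \<in> ell2_on I \<Longrightarrow> x - y \<in> ell2_on I"
  by (simp add: ell2_on_def coord_diff)

lemma ell2_on_scaleC: "x \<in> ell2_on I \<Longrightarrow> scaleC_ell2 c x \<in> ell2_on I"
  by (simp add: ell2_on_def coord_simps)

lemma ell2_on_mono: "I \<subseteq> I' \<Longrightarrow> x \<in> ell2_on I \<Longrightarrow> x \<in> ell2_on I'"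
  by (auto simp: ell2_on_def)

lemma ell2_on_finite_expand:
  assumes "finite F" "x \<in> ell2_on F"
  shows "x = (\<Sum>l\<in>F. scaleC_ell2 (coord x l) (basis_vec l))"
  by (rule ell2_eqI) (use assms in \<open>auto simp: coord_sum coord_simps ell2_on_def if_distrib[of "\<lambda>u. _ * u"]
        sum.delta' cong: if_cong\<close>)

text \<open>Finite partial sums of the squared moduli approach the total, and the squared norm of
  the remainder is their difference. This reduces convergence questions to finitely many
  coordinates.\<close>

lemma ell2_tail:
  assumes "0 < e"
  obtains F where "finite F" "norm (x - proj_on F x) < e"
proof -
  define f where "f k = (cmod (coord x k))\<^sup>2" for k
  have f: "f summable_on UNIV" unfolding f_def by (rule summable_coord)
  then have "(sum f \<longlongrightarrow> infsum f UNIV) (finite_subsets_at_top UNIV)"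
    using has_sum_def has_sum_infsum by blast
  then have "\<forall>\<^sub>F F in finite_subsets_at_top UNIV. dist (sum f F) (infsum f UNIV) < e\<^sup>2"
    by (rule tendstoD) (use assms in simp)
  then obtain F where F: "finite F" "dist (sum f F) (infsum f UNIV) < e\<^sup>2"
    by (auto simp: eventually_finite_subsets_at_top)
  have "(norm (x - proj_on F x))\<^sup>2 = (\<Sum>\<^sub>\<infinity>k\<in>UNIV - F. f k)"
    unfolding norm_ell2_sq
    by (rule infsum_cong_neutral) (auto simp: f_def coord_simps coord_diff)
  also have "\<dots> = infsum f UNIV - sum f F"
    using infsum_Diff[OF f, of F] F(1) by simp
  also have "\<dots> < e\<^sup>2" using F(2) by (simp add: dist_real_def abs_if split: if_splits)
  finally have "norm (x - proj_on F x) < e" using assms by (intro power2_less_imp_less[of _ e]) simp_all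
  show ?thesis by (rule that) fact+
qed

text \<open>Membership stabilises simultaneously on any finite \<open>F\<close>; from then on the
  two projections differ only through the part of \<open>x\<close> outside \<open>F\<close>, which
  \<open>ell2_tail\<close> makes small. Used for intervals exhausting the integers and for those
  growing to the negative half-line.\<close>

lemma tendsto_proj_on:
  fixes I :: "nat \<Rightarrow> int set"
  assumes I: "\<And>j. \<forall>\<^sub>F k in sequentially. j \<in> I k \<longleftrightarrow> j \<in> I'"
  shows "(\<lambda>k. proj_on (I k) x) \<longlonglongrightarrow> proj_on I' x"
proof (rule tendstoI)
  fix e :: real assume "0 < e"
  then obtain F where F: "finite F" "norm (x - proj_on F x) < e / 2"
    using ell2_tail[of "e / 2" x] by auto
  have "\<forall>\<^sub>F k in sequentially. \<forall>j\<in>F. j \<in> I k \<longleftrightarrow> j \<in> I'"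
    using F(1) I by (simp add: eventually_ball_finite)
  then show "\<forall>\<^sub>F k in sequentially. dist (proj_on (I k) x) (proj_on I' x) < e"
  proof eventually_elim
    case (elim k)
    let ?y = "x - proj_on F x"
    have "proj_on (I k) x - proj_on I' x = proj_on (I k) ?y - proj_on I' ?y"
      by (rule ell2_eqI) (use elim in \<open>auto simp: coord_simps coord_diff\<close>)
    also have "norm \<dots> \<le> norm ?y + norm ?y"
      by (rule order_trans[OF norm_triangle_ineq4]) (intro add_mono norm_proj_on_le)
    finally show ?case using F(2) by (simp add: dist_norm)
  qed
qed

lemma tendsto_coord: "(f \<longlongrightarrow> x) F \<Longrightarrow> ((\<lambda>k. coord (f k) j) \<longlongrightarrow> coord x j) F"
proof (rule tendstoI)
  fix e :: real assume "(f \<longlongrightarrow> x) F" "0 < e"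
  then have "\<forall>\<^sub>F k in F. dist (f k) x < e" by (rule tendstoD)
  then show "\<forall>\<^sub>F k in F. dist (coord (f k) j) (coord x j) < e"
    by eventually_elim
      (use cmod_coord_le_norm in \<open>auto simp: dist_norm coord_diff[symmetric] intro: le_less_trans\<close>)
qed

section \<open>The complex inner product\<close>

lemma summable_cinner: "(\<lambda>k. coord x k * cnj (coord y k)) summable_on UNIV"
  by (rule abs_summable_summable) (simp add: norm_mult summable_coord_prod)

lemma cinner_add_left: "cinner (x + y) z = cinner x z + cinner y z"
  unfolding cinner_def by (simp add: coord_simps distrib_right infsum_add summable_cinner)

lemma cinner_add_right: "cinner z (x + y) = cinner z x + cinner z y"
  unfolding cinner_def by (simp add: coord_simps distrib_left infsum_add summable_cinner)

lemma cinner_scaleC_left: "cinner (scaleC_ell2 c x) y = c * cinner x y"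
  unfolding cinner_def by (simp add: coord_simps mult.assoc infsum_cmult_right')

lemma cinner_scaleC_right: "cinner x (scaleC_ell2 c y) = cnj c * cinner x y"
  unfolding cinner_def by (simp add: coord_simps mult.left_commute infsum_cmult_right')

lemma cinner_diff_left: "cinner (x - y) z = cinner x z - cinner y z"
  using cinner_add_left[of "x - y" y z] by simp

lemma cinner_diff_right: "cinner z (x - y) = cinner z x - cinner z y"
  using cinner_add_right[of z "x - y" y] by simp

lemma cinner_zero_left: "cinner 0 z = 0"
  by (simp add: cinner_def coord_simps)

lemma cinner_sum_left: "cinner (sum f F) y = (\<Sum>i\<in>F. cinner (f i) y)"
  by (induction F rule: infinite_finite_induct) (simp_all add: cinner_add_left cinner_zero_left)

lemma cinner_commute: "cinner x y = cnj (cinner y x)"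
proof -
  have "cnj (cinner y x) = (\<Sum>\<^sub>\<infinity>k. cnj (coord y k * cnj (coord x k)))"
    unfolding cinner_def by (simp only: infsum_cnj)
  then show ?thesis by (simp add: cinner_def mult.commute)
qed

lemma cinner_basis_right: "cinner x (basis_vec j) = coord x j"
proof -
  have "cinner x (basis_vec j) = (\<Sum>\<^sub>\<infinity>k\<in>{j}. coord x k * cnj (coord (basis_vec j) k))"
    unfolding cinner_def by (rule infsum_cong_neutral) (auto simp: coord_simps)
  then show ?thesis by (simp add: coord_simps)
qed

lemma cinner_basis_left: "cinner (basis_vec j) y = cnj (coord y j)"
  by (subst cinner_commute) (simp add: cinner_basis_right)

lemma Re_cinner: "Re (cinner x y) = inner x y"
  unfolding cinner_def inner_ell2_def
  by (subst infsum_Re[OF summable_cinner, symmetric]) (simp add: inner_complex_def)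

lemma cmod_cinner_le: "cmod (cinner x y) \<le> norm x * norm y"
proof (cases "cinner x y = 0")
  case False
  \<comment> \<open>Rotating \<open>x\<close> by the conjugate phase makes the complex inner product
    real and nonnegative, so the real Cauchy-Schwarz inequality applies.\<close>
  define c where "c = cnj (sgn (cinner x y))"
  have c: "cmod c = 1" using False by (simp add: c_def norm_sgn)
  have "c * cinner x y = of_real (cmod (cinner x y))"
    using False by (simp add: c_def sgn_div_norm scaleR_conv_of_real complex_norm_square[symmetric]
        power2_eq_square field_simps)
  then have "cmod (cinner x y) = inner (scaleC_ell2 c x) y"
    by (metis Re_cinner Re_complex_of_real cinner_scaleC_left)
  also have "\<dots> \<le> norm (scaleC_ell2 c x) * norm y" by (rule norm_cauchy_schwarz)
  finally show ?thesis using c by (simp add: norm_scaleC)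
qed simp

section \<open>Bounded operators and their adjoints\<close>

lemma bounded_opsI:
  assumes "\<And>x. x \<in> ell2_on I \<Longrightarrow> T x \<in> ell2_on I"
    and "\<And>x y. x \<in> ell2_on I \<Longrightarrow> y \<in> ell2_on I \<Longrightarrow> T (x + y) = T x + T y"
    and "\<And>c x. x \<in> ell2_on I \<Longrightarrow> T (scaleC_ell2 c x) = scaleC_ell2 c (T x)"
    and "\<And>x. x \<in> ell2_on I \<Longrightarrow> norm (T x) \<le> K * norm x"
  shows "T \<in> bounded_ops I"
  unfolding bounded_ops_def using assms(1-3) by (auto intro!: exI[of _ K] assms(4))

lemma bounded_ops_in: "T \<in> bounded_ops I \<Longrightarrow> x \<in> ell2_on I \<Longrightarrow> T x \<in> ell2_on I"
  by (simp add: bounded_ops_def)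

lemma bounded_ops_add:
  "T \<in> bounded_ops I \<Longrightarrow> x \<in> ell2_on I \<Longrightarrow> y \<in> ell2_on I \<Longrightarrow> T (x + y) = T x + T y"
  by (simp add: bounded_ops_def)

lemma bounded_ops_scaleC:
  "T \<in> bounded_ops I \<Longrightarrow> x \<in> ell2_on I \<Longrightarrow> T (scaleC_ell2 c x) = scaleC_ell2 c (T x)"
  by (simp add: bounded_ops_def)

lemma bounded_ops_bound:
  assumes "T \<in> bounded_ops I"
  obtains K where "0 < K" "\<And>x. x \<in> ell2_on I \<Longrightarrow> norm (T x) \<le> K * norm x"
proof -
  obtain K where K: "\<forall>x\<in>ell2_on I. norm (T x) \<le> K * norm x"
    using assms unfolding bounded_ops_def by blast
  have "norm (T x) \<le> max K 1 * norm x" if "x \<in> ell2_on I" for x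
    using bspec[OF K that] mult_right_mono[of K "max K 1" "norm x"] by simp
  with that[of "max K 1"] show ?thesis by simp
qed

lemma bounded_ops_diff:
  assumes "T \<in> bounded_ops I" "x \<in> ell2_on I" "y \<in> ell2_on I"
  shows "T (x - y) = T x - T y"
  using bounded_ops_add[OF assms(1) ell2_on_diff[OF assms(2,3)] assms(3)] by simp

lemma bounded_ops_zero:
  assumes "T \<in> bounded_ops I"
  shows "T 0 = 0"
  using bounded_ops_diff[OF assms, of 0 0] by (simp add: ell2_on_def coord_simps)

lemma bounded_ops_sum:
  assumes "T \<in> bounded_ops I" "\<And>l. l \<in> F \<Longrightarrow> f l \<in> ell2_on I"
  shows "T (sum f F) = (\<Sum>l\<in>F. T (f l))"
  using assms(2)
proof (induction F rule: infinite_finite_induct)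
  case (insert l F)
  have "sum f F \<in> ell2_on I"
    using insert.prems by (auto simp: ell2_on_def coord_sum)
  with insert show ?case by (simp add: bounded_ops_add[OF assms(1)])
qed (simp_all add: bounded_ops_zero[OF assms(1)])

lemma tendsto_cinner_left:
  assumes "f \<longlonglongrightarrow> x"
  shows "(\<lambda>k. cinner (f k) y) \<longlonglongrightarrow> cinner x y"
proof (rule LIM_zero_cancel)
  have "(\<lambda>k. norm (f k - x) * norm y) \<longlonglongrightarrow> 0"
    using assms by (intro tendsto_mult_left_zero tendsto_norm_zero) (simp add: LIM_zero_iff)
  then show "(\<lambda>k. cinner (f k) y - cinner x y) \<longlonglongrightarrow> 0"
    by (rule Lim_null_comparison[rotated]) (simp add: cinner_diff_left[symmetric] cmod_cinner_le)
qed

text \<open>The adjoint is written down explicitly through its coordinates, so that no completeness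
  argument is needed.\<close>

lemma adjoint_exists:
  assumes T: "T \<in> bounded_ops UNIV"
  obtains S where "S \<in> bounded_ops UNIV" "\<And>x y. cinner (T x) y = cinner x (S y)"
proof -
  obtain K where K: "0 < K" "\<And>x. norm (T x) \<le> K * norm x"
    using bounded_ops_bound[OF T] by auto
  \<comment> \<open>The adjoint relation tested on \<open>basis_vec k\<close> forces this value for
    the coordinate of \<open>S y\<close> at \<open>k\<close>.\<close>
  define s where "s y k = cnj (cinner (T (basis_vec k)) y)" for y k
  have bound: "(\<Sum>k\<in>F. (cmod (s y k))\<^sup>2) \<le> (K * norm y)\<^sup>2" if F: "finite F" for F y
  proof -
    \<comment> \<open>Truncating the candidate to \<open>F\<close> and testing \<open>T\<close> on
      it gives the square of its norm as \<open>cinner (T u) y\<close>, hence at most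
      \<open>K * norm u * norm y\<close>; one factor \<open>norm u\<close> cancels. The resulting
      bound does not depend on \<open>F\<close>.\<close>
    define u where "u = (\<Sum>k\<in>F. scaleC_ell2 (s y k) (basis_vec k))"
    define a where "a = (\<Sum>k\<in>F. (cmod (s y k))\<^sup>2)"
    have "coord u k = (if k \<in> F then s y k else 0)" for k
      using F by (simp add: u_def coord_sum coord_simps if_distrib[of "\<lambda>v. _ * v"] sum.delta' cong: if_cong)
    then have "(norm u)\<^sup>2 = (\<Sum>\<^sub>\<infinity>k\<in>F. (cmod (s y k))\<^sup>2)"
      unfolding norm_ell2_sq by (intro infsum_cong_neutral) auto
    then have a: "(norm u)\<^sup>2 = a" using F by (simp add: a_def)
    have "cinner (T u) y = (\<Sum>k\<in>F. s y k * cnj (s y k))"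
      by (simp add: u_def bounded_ops_sum[OF T] bounded_ops_scaleC[OF T] cinner_sum_left
          cinner_scaleC_left s_def)
    also have "\<dots> = of_real a"
      by (simp only: complex_norm_square[symmetric] a_def of_real_sum)
    finally have "cmod (cinner (T u) y) = \<bar>a\<bar>" by (simp only: norm_of_real)
    then have "a = cmod (cinner (T u) y)"
      by (simp add: a_def sum_nonneg)
    also have "\<dots> \<le> norm (T u) * norm y" by (rule cmod_cinner_le)
    also have "\<dots> \<le> K * norm u * norm y" using K(2) by (intro mult_right_mono) auto
    finally have "norm u * norm u \<le> norm u * (K * norm y)"
      using a by (simp add: power2_eq_square mult_ac)
    then have "norm u \<le> K * norm y"
      using K(1) by (cases "norm u = 0") (auto simp: mult_le_cancel_left)
    then have "(norm u)\<^sup>2 \<le> (K * norm y)\<^sup>2" by (simp add: power_mono)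
    with a show ?thesis by (simp add: a_def)
  qed
  have "(\<lambda>k. (cmod (s y k))\<^sup>2) summable_on UNIV" for y
    by (rule nonneg_bdd_above_summable_on) (auto intro!: bdd_aboveI bound)
  then have coord_S: "coord (Abs_ell2 (s y)) = s y" for y
    by (simp add: Abs_ell2_inverse)
  define S where "S y = Abs_ell2 (s y)" for y
  have "S \<in> bounded_ops UNIV"
  proof (rule bounded_opsI)
    show "S (x + y) = S x + S y" for x y
      by (rule ell2_eqI) (simp add: S_def coord_simps coord_S s_def cinner_add_right)
    show "S (scaleC_ell2 c x) = scaleC_ell2 c (S x)" for c x
      by (rule ell2_eqI) (simp add: S_def coord_simps coord_S s_def cinner_scaleC_right)
    have "(norm (S x))\<^sup>2 \<le> (K * norm x)\<^sup>2" for x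
      by (rule norm_sq_le_sums) (simp add: S_def coord_S bound)
    then show "norm (S x) \<le> K * norm x" for x
      using K(1) power2_le_imp_le[of "norm (S x)" "K * norm x"] by simp
  qed simp
  \<comment> \<open>Both sides are continuous in \<open>x\<close> and agree on finitely supported
    vectors by the choice of \<open>s\<close>.\<close>
  moreover have "cinner (T x) y = cinner x (S y)" for x y
  proof (rule LIMSEQ_unique)
    define F where "F n = {- int n..int n}" for n
    have "\<forall>\<^sub>F n in sequentially. j \<in> F n \<longleftrightarrow> j \<in> UNIV" for j
      by (rule eventually_sequentiallyI[of "nat \<bar>j\<bar>"]) (auto simp: F_def)
    then have lim: "(\<lambda>n. proj_on (F n) x) \<longlonglongrightarrow> x"
      using tendsto_proj_on[of F UNIV x] proj_on_id[of x UNIV] by simp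
    then have "(\<lambda>n. norm (proj_on (F n) x - x)) \<longlonglongrightarrow> 0"
      by (simp add: LIM_zero_iff tendsto_norm_zero)
    then have "(\<lambda>n. K * norm (proj_on (F n) x - x)) \<longlonglongrightarrow> 0"
      by (rule tendsto_mult_right_zero)
    then have "(\<lambda>n. T (proj_on (F n) x) - T x) \<longlonglongrightarrow> 0"
      by (rule Lim_null_comparison[rotated]) (simp add: bounded_ops_diff[OF T, symmetric] K)
    then have "(\<lambda>n. T (proj_on (F n) x)) \<longlonglongrightarrow> T x" by (simp add: LIM_zero_iff)
    then show "(\<lambda>n. cinner (T (proj_on (F n) x)) y) \<longlonglongrightarrow> cinner (T x) y"
      by (rule tendsto_cinner_left)
    have "cinner (T (proj_on (F n) x)) y = cinner (proj_on (F n) x) (S y)" for n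
    proof -
      have e: "proj_on (F n) x = (\<Sum>l\<in>F n. scaleC_ell2 (coord (proj_on (F n) x) l) (basis_vec l))"
        by (rule ell2_on_finite_expand) (simp_all add: F_def proj_on_in_ell2_on)
      show ?thesis
        by (subst (1 2) e)
          (simp add: bounded_ops_sum[OF T] bounded_ops_scaleC[OF T] cinner_sum_left
            cinner_scaleC_left cinner_basis_left S_def coord_S s_def)
    qed
    then show "(\<lambda>n. cinner (T (proj_on (F n) x)) y) \<longlonglongrightarrow> cinner x (S y)"
      using tendsto_cinner_left[OF lim, of "S y"] by simp
  qed
  ultimately show ?thesis by (rule that)
qed

text \<open>Since \<open>adj\<close> is a definite description, existence has to be joined by
  uniqueness: testing against basis vectors determines every coordinate of a candidate.\<close>

lemma cinner_adj:
  assumes "T \<in> bounded_ops UNIV"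
  shows "cinner (T x) y = cinner x (adj T y)"
proof -
  obtain S where S: "S \<in> bounded_ops UNIV" "\<And>x y. cinner (T x) y = cinner x (S y)"
    using adjoint_exists[OF assms] by blast
  have "adj T = S"
    unfolding adj_def
  proof (rule the_equality)
    show "S \<in> bounded_ops UNIV \<and> (\<forall>x y. cinner (T x) y = cinner x (S y))" using S by simp
    fix S' assume S': "S' \<in> bounded_ops UNIV \<and> (\<forall>x y. cinner (T x) y = cinner x (S' y))"
    show "S' = S"
    proof (rule ext, rule ell2_eqI)
      fix y k
      have "cinner (basis_vec k) (S' y) = cinner (basis_vec k) (S y)" using S S' by metis
      then show "coord (S' y) k = coord (S y) k" by (simp add: cinner_basis_left)
    qed
  qed
  with S show ?thesis by simp
qed

text \<open>The lower estimate plays two roles: it gives injectivity, from which linearity of a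
  chosen preimage map follows, and it bounds that map by \<open>C\<close>.\<close>

lemma invertible_onI:
  assumes T: "T \<in> bounded_ops I"
    and lower: "\<And>x. x \<in> ell2_on I \<Longrightarrow> norm x \<le> C * norm (T x)"
    and surj: "\<And>y. y \<in> ell2_on I \<Longrightarrow> \<exists>x\<in>ell2_on I. T x = y"
  shows "invertible_on I T"
proof -
  have inj: "x = y" if "x \<in> ell2_on I" "y \<in> ell2_on I" "T x = T y" for x y
    using lower[OF ell2_on_diff[OF that(1,2)]] that by (simp add: bounded_ops_diff[OF T])
  obtain S where S: "\<And>y. y \<in> ell2_on I \<Longrightarrow> S y \<in> ell2_on I \<and> T (S y) = y"
    using surj by metis
  have "S \<in> bounded_ops I"
  proof (rule bounded_opsI)
    show "S (x + y) = S x + S y" if "x \<in> ell2_on I" "y \<in> ell2_on I" for x y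
      using that by - (rule inj; simp add: S ell2_on_add bounded_ops_add[OF T])
    show "S (scaleC_ell2 c x) = scaleC_ell2 c (S x)" if "x \<in> ell2_on I" for x c
      using that by - (rule inj; simp add: S ell2_on_scaleC bounded_ops_scaleC[OF T])
    show "norm (S x) \<le> C * norm x" if "x \<in> ell2_on I" for x
      using lower[of "S x"] S[OF that] by simp
  qed (simp add: S)
  moreover have "\<forall>x\<in>ell2_on I. S (T x) = x \<and> T (S x) = x"
    using S bounded_ops_in[OF T] inj by metis
  ultimately show ?thesis using T by (auto simp: invertible_on_def)
qed

lemma inverse_on_left:
  assumes "invertible_on I T" "x \<in> ell2_on I"
  shows "inverse_on I T (T x) = x"
proof -
  have "inj_on T (ell2_on I)"
    using assms(1) unfolding invertible_on_def by (metis inj_onI)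
  then show ?thesis using assms(2) by (simp add: inverse_on_def)
qed

lemma invertible_on_surj:
  assumes "invertible_on I T" "y \<in> ell2_on I"
  obtains x where "x \<in> ell2_on I" "T x = y"
  using assms bounded_ops_in unfolding invertible_on_def by metis

section \<open>Weak limits\<close>

text \<open>Sequential weak compactness of balls. The coordinate functions lie in a product of
  closed discs, compact by Tychonoff; the product over the countable set of integers is metrizable,
  so subsequences converge.\<close>

lemma bounded_coordinatewise_subseq:
  fixes x :: "nat \<Rightarrow> ell2"
  assumes M: "\<And>k. norm (x k) \<le> M"
  shows "\<exists>r y. strict_mono r \<and> (\<forall>j. (\<lambda>k. coord (x (r k)) j) \<longlonglongrightarrow> coord y j)"
proof -
  have "compact (PiE UNIV (\<lambda>_ :: int. cball (0 :: complex) M))"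
    using compactin_PiE[of "\<lambda>_. euclidean" UNIV "\<lambda>_ :: int. cball (0 :: complex) M"]
    by (simp add: euclidean_product_topology)
  moreover have "coord (x k) \<in> PiE UNIV (\<lambda>_. cball 0 M)" for k
    using order_trans[OF cmod_coord_le_norm M] by (simp add: PiE_UNIV_domain)
  ultimately obtain f r where r: "strict_mono r" "((\<lambda>k. coord (x k)) \<circ> r) \<longlonglongrightarrow> f"
    unfolding compact_def by meson
  have lim: "(\<lambda>k. coord (x (r k)) j) \<longlonglongrightarrow> f j" for j
  proof -
    have "isCont (\<lambda>g :: int \<Rightarrow> complex. g j) f"
      using continuous_on_eq_continuous_at[of UNIV "\<lambda>g :: int \<Rightarrow> complex. g j"] by simp
    then show ?thesis using isCont_tendsto_compose[OF _ r(2)] by (simp add: o_def)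
  qed
  \<comment> \<open>The product limit is a mere function; bounding its finite partial sums places it
    in the Hilbert space.\<close>
  have "(\<Sum>j\<in>F. (cmod (f j))\<^sup>2) \<le> M\<^sup>2" if "finite F" for F
  proof (rule tendsto_upperbound)
    show "(\<lambda>k. \<Sum>j\<in>F. (cmod (coord (x (r k)) j))\<^sup>2) \<longlonglongrightarrow> (\<Sum>j\<in>F. (cmod (f j))\<^sup>2)"
      by (intro tendsto_intros lim)
    have "(\<Sum>j\<in>F. (cmod (coord (x (r k)) j))\<^sup>2) \<le> M\<^sup>2" for k
      using sum_sq_coord_le_norm[OF that, of "x (r k)"] M[of "r k"]
        power_mono[of "norm (x (r k))" M 2] by simp
    then show "\<forall>\<^sub>F k in sequentially. (\<Sum>j\<in>F. (cmod (coord (x (r k)) j))\<^sup>2) \<le> M\<^sup>2" by simp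
  qed simp
  then have "(\<lambda>j. (cmod (f j))\<^sup>2) summable_on UNIV"
    by (intro nonneg_bdd_above_summable_on) (auto intro!: bdd_aboveI)
  then have "coord (Abs_ell2 f) = f" by (simp add: Abs_ell2_inverse)
  with lim r(1) show ?thesis by (intro exI[of _ r] exI[of _ "Abs_ell2 f"]) simp
qed

text \<open>A bounded, coordinatewise convergent factor may be paired with a norm convergent one: up
  to a small tail, the fixed limit \<open>y'\<close> involves finitely many coordinates.\<close>

lemma tendsto_cinner_weak:
  fixes x y :: "nat \<Rightarrow> ell2"
  assumes M: "\<And>k. norm (x k) \<le> M"
    and x: "\<And>j. (\<lambda>k. coord (x k) j) \<longlonglongrightarrow> coord x' j"
    and y: "y \<longlonglongrightarrow> y'"
  shows "(\<lambda>k. cinner (x k) (y k)) \<longlonglongrightarrow> cinner x' y'"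
proof (rule tendstoI)
  fix e :: real assume e: "0 < e"
  \<comment> \<open>Chosen to dominate \<open>2 * \<bar>M\<bar> + norm x'\<close>, the total factor
    of the two error terms of size \<open>e / (2 * L)\<close>. They then cost at most
    \<open>e / 2\<close>, and the finite part costs \<open>e / 4\<close>.\<close>
  define L where "L = 2 * (\<bar>M\<bar> + norm x' + 1)"
  have L: "0 < L" by (auto simp: L_def intro: add_nonneg_pos)
  obtain F where F: "finite F" "norm (y' - proj_on F y') < e / (2 * L)"
    using ell2_tail[of "e / (2 * L)" y'] e L by auto
  define w where "w = y' - proj_on F y'"
  have fin: "cinner u (proj_on F y') = (\<Sum>j\<in>F. coord u j * cnj (coord y' j))" for u
  proof -
    have "cinner u (proj_on F y') = (\<Sum>\<^sub>\<infinity>j\<in>F. coord u j * cnj (coord y' j))"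
      unfolding cinner_def by (rule infsum_cong_neutral) (auto simp: coord_simps)
    then show ?thesis using F(1) by simp
  qed
  have "(\<lambda>k. cinner (x k) (proj_on F y')) \<longlonglongrightarrow> cinner x' (proj_on F y')"
    unfolding fin by (intro tendsto_intros x)
  then have ev1: "\<forall>\<^sub>F k in sequentially. dist (cinner (x k) (proj_on F y')) (cinner x' (proj_on F y')) < e / 4"
    by (rule tendstoD) (use e in simp)
  have ev2: "\<forall>\<^sub>F k in sequentially. dist (y k) y' < e / (2 * L)"
    using y by (rule tendstoD) (use e L in simp)
  from ev1 ev2 show "\<forall>\<^sub>F k in sequentially. dist (cinner (x k) (y k)) (cinner x' y') < e"
  proof eventually_elim
    case (elim k)
    have xk: "norm (x k) \<le> \<bar>M\<bar>" using M[of k] by simp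
    have "cinner (x k) (y k) - cinner x' y' = cinner (x k) (y k - y') + cinner (x k - x') w
        + (cinner (x k) (proj_on F y') - cinner x' (proj_on F y'))"
      by (simp add: w_def cinner_diff_right cinner_diff_left)
    also have "cmod \<dots> \<le> cmod (cinner (x k) (y k - y')) + cmod (cinner (x k - x') w)
        + cmod (cinner (x k) (proj_on F y') - cinner x' (proj_on F y'))"
      by (intro norm_triangle_mono norm_triangle_ineq order_refl)
    also have "\<dots> \<le> \<bar>M\<bar> * (e / (2 * L)) + (\<bar>M\<bar> + norm x') * (e / (2 * L)) + e / 4"
    proof (intro add_mono)
      show "cmod (cinner (x k) (y k - y')) \<le> \<bar>M\<bar> * (e / (2 * L))"
        using elim(2) xk
        by (intro order_trans[OF cmod_cinner_le] mult_mono) (auto simp: dist_norm)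
      show "cmod (cinner (x k - x') w) \<le> (\<bar>M\<bar> + norm x') * (e / (2 * L))"
        using F(2) xk norm_triangle_ineq4[of "x k" x']
        by (intro order_trans[OF cmod_cinner_le] mult_mono) (auto simp: w_def)
    qed (use elim(1) in \<open>simp add: dist_norm\<close>)
    also have "\<dots> = (\<bar>M\<bar> + (\<bar>M\<bar> + norm x')) * (e / (2 * L)) + e / 4"
      by (simp only: distrib_right add.assoc)
    also have "\<dots> \<le> L * (e / (2 * L)) + e / 4"
      using e L by (intro add_mono mult_right_mono) (auto simp: L_def)
    also have "\<dots> < e" using e L by simp
    finally show ?case by (simp add: dist_norm)
  qed
qed

section \<open>Uniformly invertible compressions of a convergent sequence of operators\<close>

text \<open>Isolates the limit argument from translations and sections. Later \<open>T k\<close> is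
  the conjugate of the extended operator by a shift, \<open>I k\<close> the translated section
  interval and \<open>I'\<close> the negative half-line. Uniform invertibility is split into
  \<open>lower\<close> and \<open>surj\<close>, because the two pass to the limit by different
  arguments.\<close>

locale stable_compressions =
  fixes T :: "nat \<Rightarrow> ell2 \<Rightarrow> ell2" and B :: "ell2 \<Rightarrow> ell2"
    and I :: "nat \<Rightarrow> int set" and I' :: "int set" and K C :: real
  assumes T: "\<And>k. T k \<in> bounded_ops UNIV"
    and T_bound: "\<And>k x. norm (T k x) \<le> K * norm x"
    and B: "B \<in> bounded_ops UNIV"
    and lim: "\<And>x. (\<lambda>k. T k x) \<longlonglongrightarrow> B x"
    and lim_adj: "\<And>x. (\<lambda>k. adj (T k) x) \<longlonglongrightarrow> adj B x"
    and I_subset: "\<And>k. I k \<subseteq> I'"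
    and I_lim: "\<And>j. \<forall>\<^sub>F k in sequentially. j \<in> I k \<longleftrightarrow> j \<in> I'"
    and lower: "\<forall>\<^sub>F k in sequentially. \<forall>x\<in>ell2_on (I k). norm x \<le> C * norm (proj_on (I k) (T k x))"
    and surj: "\<forall>\<^sub>F k in sequentially. \<forall>y\<in>ell2_on (I k). \<exists>x\<in>ell2_on (I k). proj_on (I k) (T k x) = y"
begin

lemma proj_tendsto:
  assumes "z \<longlonglongrightarrow> z'"
  shows "(\<lambda>k. proj_on (I k) (z k)) \<longlonglongrightarrow> proj_on I' z'"
proof (rule Lim_transform)
  show "(\<lambda>k. proj_on (I k) z') \<longlonglongrightarrow> proj_on I' z'"
    by (rule tendsto_proj_on) (rule I_lim)
  have "(\<lambda>k. norm (z k - z')) \<longlonglongrightarrow> 0"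
    using assms by (simp add: LIM_zero_iff tendsto_norm_zero)
  then show "(\<lambda>k. proj_on (I k) (z k) - proj_on (I k) z') \<longlonglongrightarrow> 0"
    by (rule Lim_null_comparison[rotated]) (simp add: proj_on_diff[symmetric] norm_proj_on_le)
qed

text \<open>The common bound \<open>K\<close> absorbs the varying argument: replacing
  \<open>z k\<close> by its limit changes the image by at most
  \<open>K * norm (z k - z')\<close>.\<close>

lemma compression_tendsto:
  assumes "z \<longlonglongrightarrow> z'"
  shows "(\<lambda>k. proj_on (I k) (T k (z k))) \<longlonglongrightarrow> proj_on I' (B z')"
proof (rule proj_tendsto, rule Lim_transform)
  show "(\<lambda>k. T k z') \<longlonglongrightarrow> B z'" by (rule lim)
  have "(\<lambda>k. norm (z k - z')) \<longlonglongrightarrow> 0"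
    using assms by (simp add: LIM_zero_iff tendsto_norm_zero)
  then have "(\<lambda>k. K * norm (z k - z')) \<longlonglongrightarrow> 0"
    by (rule tendsto_mult_right_zero)
  then show "(\<lambda>k. T k (z k) - T k z') \<longlonglongrightarrow> 0"
    by (rule Lim_null_comparison[rotated]) (simp add: bounded_ops_diff[OF T, symmetric] T_bound)
qed

lemma proj_I_tendsto_self: "x \<in> ell2_on I' \<Longrightarrow> (\<lambda>k. proj_on (I k) x) \<longlonglongrightarrow> x"
  using proj_tendsto[OF tendsto_const, of x] by (simp add: proj_on_id)

text \<open>A vector of the limit space need not lie in any \<open>ell2_on (I k)\<close>, so the
  estimate is applied to its truncations, which converge to it.\<close>

lemma limit_lower:
  assumes x: "x \<in> ell2_on I'"
  shows "norm x \<le> C * norm (proj_on I' (B x))"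
proof (rule tendsto_le[OF sequentially_bot])
  show "(\<lambda>k. norm (proj_on (I k) x)) \<longlonglongrightarrow> norm x"
    by (intro tendsto_norm proj_I_tendsto_self x)
  show "(\<lambda>k. C * norm (proj_on (I k) (T k (proj_on (I k) x)))) \<longlonglongrightarrow> C * norm (proj_on I' (B x))"
    by (intro tendsto_intros compression_tendsto proj_I_tendsto_self x)
  show "\<forall>\<^sub>F k in sequentially. norm (proj_on (I k) x) \<le> C * norm (proj_on (I k) (T k (proj_on (I k) x)))"
    using lower by eventually_elim (simp add: proj_on_in_ell2_on)
qed

text \<open>Strong convergence of the inverses, stated through solutions. The truncation
  \<open>w k\<close> of the expected limit lies in the same space as \<open>z k\<close>, so
  \<open>lower\<close> controls their distance by the distance of their images, and both images have
  the same limit.\<close>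

lemma solutions_tendsto:
  assumes x: "x \<in> ell2_on I'"
    and z: "\<forall>\<^sub>F k in sequentially. z k \<in> ell2_on (I k)"
    and Tz: "(\<lambda>k. proj_on (I k) (T k (z k))) \<longlonglongrightarrow> proj_on I' (B x)"
  shows "z \<longlonglongrightarrow> x"
proof (rule Lim_transform2)
  define w where "w k = proj_on (I k) x" for k
  show "w \<longlonglongrightarrow> x" unfolding w_def by (rule proj_I_tendsto_self[OF x])
  have "(\<lambda>k. proj_on (I k) (T k (w k)) - proj_on (I k) (T k (z k))) \<longlonglongrightarrow> 0"
    using tendsto_diff[OF compression_tendsto[OF \<open>w \<longlonglongrightarrow> x\<close>] Tz] by simp
  then have "(\<lambda>k. C * norm (proj_on (I k) (T k (w k)) - proj_on (I k) (T k (z k)))) \<longlonglongrightarrow> 0"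
    by (intro tendsto_mult_right_zero tendsto_norm_zero)
  moreover have "\<forall>\<^sub>F k in sequentially. norm (w k - z k)
      \<le> C * norm (proj_on (I k) (T k (w k)) - proj_on (I k) (T k (z k)))"
    using lower z
  proof eventually_elim
    case (elim k)
    have "w k - z k \<in> ell2_on (I k)"
      using elim(2) by (simp add: w_def ell2_on_diff proj_on_in_ell2_on)
    with elim(1) show ?case
      by (fastforce simp: bounded_ops_diff[OF T] proj_on_diff)
  qed
  ultimately show "(\<lambda>k. w k - z k) \<longlonglongrightarrow> 0" by (rule Lim_null_comparison[rotated])
qed

text \<open>A weak limit of solutions of the compressed equations solves the limit equation; this is
  where the strong convergence of the adjoints enters.\<close>

lemma limit_surj:
  assumes y: "y \<in> ell2_on I'"
  obtains x where "x \<in> ell2_on I'" "proj_on I' (B x) = y"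
proof -
  define sol where "sol k x \<longleftrightarrow> x \<in> ell2_on (I k) \<and> proj_on (I k) (T k x) = proj_on (I k) y
    \<and> norm x \<le> C * norm (proj_on (I k) y)" for k x
  have "\<forall>\<^sub>F k in sequentially. \<exists>x. sol k x"
    using lower surj
  proof eventually_elim
    case (elim k)
    then obtain x where "x \<in> ell2_on (I k)" "proj_on (I k) (T k x) = proj_on (I k) y"
      using proj_on_in_ell2_on by blast
    with elim(1) show ?case unfolding sol_def by metis
  qed
  then obtain N where N: "\<And>k. k \<ge> N \<Longrightarrow> \<exists>x. sol k x" by (auto simp: eventually_sequentially)
  \<comment> \<open>Starting at \<open>N\<close> makes every member a genuine solution, as the norm
    bound must hold for all indices when a subsequence is extracted.\<close>
  define z where "z k = (SOME x. sol (N + k) x)" for k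
  have z: "sol (N + k) (z k)" for k
    unfolding z_def by (rule someI_ex) (simp add: N)
  have z_bound: "norm (z k) \<le> \<bar>C\<bar> * norm y" for k
  proof -
    have "norm (z k) \<le> C * norm (proj_on (I (N + k)) y)" using z by (simp add: sol_def)
    also have "\<dots> \<le> \<bar>C\<bar> * norm y" by (intro mult_mono norm_proj_on_le) auto
    finally show ?thesis .
  qed
  obtain r x where r: "strict_mono r" and x': "\<forall>j. (\<lambda>k. coord (z (r k)) j) \<longlonglongrightarrow> coord x j"
    using bounded_coordinatewise_subseq[of z, OF z_bound] by blast
  note x = x'[rule_format]
  define s where "s k = N + r k" for k
  have s: "strict_mono s" using r by (simp add: s_def strict_mono_def)
  have "coord x j = 0" if "j \<notin> I'" for j
  proof (rule LIMSEQ_unique[OF x])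
    have "coord (z (r k)) j = 0" for k
      using z[of "r k"] I_subset[of "N + r k"] that by (auto simp: sol_def ell2_on_def)
    then show "(\<lambda>k. coord (z (r k)) j) \<longlonglongrightarrow> 0" by simp
  qed
  then have x_in: "x \<in> ell2_on I'" by (simp add: ell2_on_def)
  have "coord (B x) j = coord y j" if j: "j \<in> I'" for j
  proof (rule LIMSEQ_unique)
    \<comment> \<open>Coordinate \<open>j\<close> of \<open>T (s k) (z (r k))\<close> pairs the
      weakly convergent solutions with these norm convergent vectors.\<close>
    have "(\<lambda>k. adj (T (s k)) (basis_vec j)) \<longlonglongrightarrow> adj B (basis_vec j)"
      using LIMSEQ_subseq_LIMSEQ[OF lim_adj s] by (simp add: o_def)
    with z_bound x have
      "(\<lambda>k. cinner (z (r k)) (adj (T (s k)) (basis_vec j))) \<longlonglongrightarrow> cinner x (adj B (basis_vec j))"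
      by (rule tendsto_cinner_weak)
    then show "(\<lambda>k. coord (T (s k) (z (r k))) j) \<longlonglongrightarrow> coord (B x) j"
      by (simp add: cinner_adj[OF T, symmetric] cinner_adj[OF B, symmetric] cinner_basis_right)
    have "\<forall>\<^sub>F k in sequentially. j \<in> I (s k) \<longleftrightarrow> j \<in> I'"
      using eventually_subseq[OF s I_lim] .
    then have "\<forall>\<^sub>F k in sequentially. coord (T (s k) (z (r k))) j = coord y j"
    proof eventually_elim
      case (elim k)
      have "coord (proj_on (I (s k)) (T (s k) (z (r k)))) j = coord (proj_on (I (s k)) y) j"
        using z[of "r k"] by (simp add: sol_def s_def)
      with elim j show ?case by (simp add: coord_simps)
    qed
    then show "(\<lambda>k. coord (T (s k) (z (r k))) j) \<longlonglongrightarrow> coord y j"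
      by (rule tendsto_eventually)
  qed
  then have "proj_on I' (B x) = y"
    using y by (intro ell2_eqI) (auto simp: coord_simps ell2_on_def)
  with x_in show ?thesis by (rule that)
qed

end

section \<open>Finite sections\<close>

lemma P_id: "x \<in> ell2_on {0..<int n} \<Longrightarrow> P x = x"
  unfolding P_def by (rule proj_on_id, rule ell2_on_mono[of "{0..<int n}"]) auto

text \<open>The identity summand on the negative half-line vanishes on section vectors, so passing
  to the two-sided operator leaves the finite sections unchanged.\<close>

lemma Pn_extend_op:
  assumes "x \<in> ell2_on {0..<int n}"
  shows "Pn n (extend_op A x) = (Pn n \<circ> A \<circ> Pn n) x"
proof -
  have "Pn n x = x" using assms by (simp add: Pn_def proj_on_id)
  moreover have "Pn n (P z) = Pn n z" for z
    by (rule ell2_eqI) (simp add: Pn_def P_def coord_simps)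
  ultimately show ?thesis using P_id[OF assms] by (simp add: extend_op_def Q_def)
qed

lemma coord_bounded_op_section:
  assumes T: "T \<in> bounded_ops {0..<int n}" and x: "x \<in> ell2_on {0..<int n}"
  shows "coord (T x) i = (\<Sum>l<n. entry T i (int l) * coord x (int l))"
proof -
  have basis: "basis_vec (int l) \<in> ell2_on {0..<int n}" if "l < n" for l
    using that by (auto simp: ell2_on_def coord_simps)
  have "bij_betw int {..<n} {0..<int n}"
    by (rule bij_betw_byWitness[of _ nat]) auto
  then have "x = (\<Sum>l<n. scaleC_ell2 (coord x (int l)) (basis_vec (int l)))"
    using ell2_on_finite_expand[OF _ x]
      sum.reindex_bij_betw[of int "{..<n}" "{0..<int n}"
        "\<lambda>l. scaleC_ell2 (coord x l) (basis_vec l)"] by simp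
  then have "T x = T (\<Sum>l<n. scaleC_ell2 (coord x (int l)) (basis_vec (int l)))" by simp
  also have "\<dots> = (\<Sum>l<n. scaleC_ell2 (coord x (int l)) (T (basis_vec (int l))))"
    by (subst bounded_ops_sum[OF T])
      (auto intro!: sum.cong bounded_ops_scaleC[OF T] ell2_on_scaleC basis)
  finally show ?thesis
    by (simp add: coord_sum coord_simps entry_def mult.commute)
qed

lemma det_section_mat_pred:
  assumes n: "0 < n"
    and inv: "invertible_on {0..<int n} (Pn n \<circ> A \<circ> Pn n)"
    and x: "x \<in> ell2_on {0..<int n}" "(Pn n \<circ> A \<circ> Pn n) x = basis_vec (int n - 1)"
  shows "Determinant.det (section_mat A (n - 1)) = coord x (int n - 1) * Determinant.det (section_mat A n)"
proof -
  let ?T = "Pn n \<circ> A \<circ> Pn n"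
  let ?M = "section_mat A n"
  have T: "?T \<in> bounded_ops {0..<int n}" using inv by (simp add: invertible_on_def)
  define v where "v = Matrix.vec n (\<lambda>i. coord x (int i))"
  have v: "v \<in> carrier_vec n" by (simp add: v_def)
  have M: "?M \<in> carrier_mat n n" by (simp add: section_mat_def)
  have Mv: "?M *\<^sub>v v = unit_vec n (n - 1)"
  proof (rule eq_vecI)
    fix i assume "i < dim_vec (unit_vec n (n - 1))"
    then have i: "i < n" by simp
    have "(?M *\<^sub>v v) $ i = (\<Sum>l<n. entry ?T (int i) (int l) * coord x (int l))"
      using i by (simp add: section_mat_def v_def scalar_prod_def lessThan_atLeast0)
    also have "\<dots> = coord (?T x) (int i)"
      by (simp only: coord_bounded_op_section[OF T x(1)])
    also have "\<dots> = unit_vec n (n - 1) $ i"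
      using i n unfolding x(2) by (auto simp: coord_simps unit_vec_def)
    finally show "(?M *\<^sub>v v) $ i = unit_vec n (n - 1) $ i" .
  qed (simp add: section_mat_def)
  \<comment> \<open>By Cramer, the determinant of \<open>R\<close> is the last coordinate of
    \<open>x\<close> times that of the section. Its last column is the last unit vector, so the
    expansion keeps one term, of sign +1 since row and column index coincide; the remaining minor is
    the preceding section.\<close>
  define R where "R = replace_col ?M (unit_vec n (n - 1)) (n - 1)"
  have R: "R \<in> carrier_mat n n" by (simp add: R_def replace_col_def section_mat_def)
  have "coord x (int n - 1) * Determinant.det ?M = Determinant.det R"
  proof -
    have "v $ (n - 1) = coord x (int n - 1)" using n by (simp add: v_def of_nat_diff)
    then show ?thesis
      using cramer_lemma_mat[OF M v, of "n - 1"] n unfolding R_def Mv by simp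
  qed
  also have "\<dots> = (\<Sum>i<n. R $$ (i, n - 1) * cofactor R i (n - 1))"
    by (rule laplace_expansion_column[OF R]) (use n in simp)
  also have "\<dots> = (\<Sum>i\<in>{n - 1}. R $$ (i, n - 1) * cofactor R i (n - 1))"
    using n by (intro sum.mono_neutral_right)
      (auto simp: R_def replace_col_def section_mat_def unit_vec_def)
  also have "\<dots> = Determinant.det (mat_delete R (n - 1) (n - 1))"
    using n by (simp add: R_def replace_col_def section_mat_def unit_vec_def cofactor_def)
  also have "mat_delete R (n - 1) (n - 1) = section_mat A (n - 1)"
  proof (rule eq_matI)
    fix i j assume "i < dim_row (section_mat A (n - 1))" "j < dim_col (section_mat A (n - 1))"
    then have ij: "i < n - 1" "j < n - 1" by (simp_all add: section_mat_def)
    have "Pn m (basis_vec (int j)) = basis_vec (int j)" if "j < m" for m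
      using that by (intro ell2_eqI) (auto simp: Pn_def coord_simps)
    then have "entry (Pn n \<circ> A \<circ> Pn n) (int i) (int j)
        = entry (Pn (n - 1) \<circ> A \<circ> Pn (n - 1)) (int i) (int j)"
      using ij by (simp add: entry_def) (simp add: Pn_def coord_simps)
    then show "mat_delete R (n - 1) (n - 1) $$ (i, j) = section_mat A (n - 1) $$ (i, j)"
      using ij by (simp add: mat_delete_def R_def replace_col_def section_mat_def)
  qed (simp_all add: mat_delete_def R_def replace_col_def section_mat_def)
  finally show ?thesis by simp
qed

text \<open>Carries operator invertibility over to matrices: the entries of a kernel vector, used as
  coordinates, would form a nonzero vector killed by the injective section.\<close>

lemma det_section_mat_nonzero:
  assumes inv: "invertible_on {0..<int n} (Pn n \<circ> A \<circ> Pn n)"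
  shows "Determinant.det (section_mat A n) \<noteq> 0"
proof
  let ?T = "Pn n \<circ> A \<circ> Pn n"
  have T: "?T \<in> bounded_ops {0..<int n}" using inv by (simp add: invertible_on_def)
  assume "Determinant.det (section_mat A n) = 0"
  then obtain v where v: "v \<in> carrier_vec n" "v \<noteq> 0\<^sub>v n" "section_mat A n *\<^sub>v v = 0\<^sub>v n"
    using det_0_iff_vec_prod_zero[of "section_mat A n" n] by (auto simp: section_mat_def)
  define x where "x = (\<Sum>l<n. scaleC_ell2 (v $ l) (basis_vec (int l)))"
  have coord_x: "coord x (int i) = v $ i" if "i < n" for i
    using that by (simp add: x_def coord_sum coord_simps if_distrib[of "\<lambda>u. _ * u"] sum.delta' cong: if_cong)
  have x: "x \<in> ell2_on {0..<int n}"
    unfolding x_def ell2_on_def by (auto simp: coord_sum coord_simps intro!: sum.neutral)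
  have "coord (?T x) (int i) = 0" if "i < n" for i
  proof -
    have "(section_mat A n *\<^sub>v v) $ i = (\<Sum>l<n. entry ?T (int i) (int l) * v $ l)"
      using that v(1) by (simp add: section_mat_def scalar_prod_def lessThan_atLeast0)
    with v(3) that show ?thesis
      unfolding coord_bounded_op_section[OF T x] by (simp add: coord_x)
  qed
  then have "coord (?T x) j = 0" for j
  proof (cases "j \<in> {0..<int n}")
    case True
    then have "j = int (nat j)" "nat j < n" by auto
    with \<open>\<And>i. i < n \<Longrightarrow> coord (?T x) (int i) = 0\<close> show ?thesis by metis
  next
    case False
    then show ?thesis using bounded_ops_in[OF T x] by (simp add: ell2_on_def)
  qed
  then have "?T x = 0" by (intro ell2_eqI) (simp add: coord_simps)
  then have "x = 0"
    using inverse_on_left[OF inv x] inverse_on_left[OF inv, of 0] bounded_ops_zero[OF T]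
    by (simp add: ell2_on_def coord_simps)
  then have "v = 0\<^sub>v n"
    using v(1) coord_x by (intro eq_vecI) (auto simp: coord_simps)
  with v(2) show False ..
qed

text \<open>Removing the last coordinate \<open>c\<close> leaves \<open>x'\<close> with
  \<open>Pn (n - 1) (A x')\<close> of norm at most \<open>K\<close> times the modulus of
  \<open>c\<close>. Stability gives the factor \<open>C * K\<close> for \<open>x'\<close>, the
  removed part adds 1, and a final factor \<open>K\<close> comes from applying \<open>A\<close> to
  \<open>x\<close>, whose section image has norm 1.\<close>

lemma corner_lower_bound:
  assumes n: "0 < n"
    and A: "A \<in> bounded_ops Zplus" and K: "0 < K" "\<And>x. x \<in> ell2_on Zplus \<Longrightarrow> norm (A x) \<le> K * norm x"
    and C: "0 \<le> C" "\<And>x. x \<in> ell2_on {0..<int (n - 1)} \<Longrightarrow> norm x \<le> C * norm (Pn (n - 1) (A x))"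
    and x: "x \<in> ell2_on {0..<int n}" "Pn n (A x) = basis_vec (int n - 1)"
  shows "1 \<le> K * (1 + C * K) * cmod (coord x (int n - 1))"
proof -
  define c where "c = coord x (int n - 1)"
  let ?e = "basis_vec (int n - 1)"
  define x' where "x' = x - scaleC_ell2 c ?e"
  have x': "x' \<in> ell2_on {0..<int (n - 1)}"
    using x(1) n by (auto simp: x'_def ell2_on_def coord_diff coord_simps c_def of_nat_diff)
  have e: "?e \<in> ell2_on Zplus" using n by (auto simp: ell2_on_def coord_simps)
  have xZ: "x \<in> ell2_on Zplus" by (rule ell2_on_mono[OF _ x(1)]) auto
  have "Pn (n - 1) (A x) = Pn (n - 1) (Pn n (A x))"
    by (rule ell2_eqI) (auto simp: Pn_def coord_simps)
  also have "\<dots> = 0"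
    unfolding x(2) using n by (intro ell2_eqI) (auto simp: Pn_def coord_simps of_nat_diff)
  finally have "Pn (n - 1) (A x') = - Pn (n - 1) (scaleC_ell2 c (A ?e))"
    using xZ e
    by (simp add: x'_def bounded_ops_diff[OF A] bounded_ops_scaleC[OF A] ell2_on_scaleC Pn_def proj_on_diff)
  then have "norm (Pn (n - 1) (A x')) \<le> norm (scaleC_ell2 c (A ?e))"
    by (simp add: Pn_def norm_proj_on_le)
  also have "\<dots> \<le> cmod c * K"
    using K(2)[OF e] by (simp add: norm_scaleC norm_basis_vec mult_left_mono)
  finally have "norm (Pn (n - 1) (A x')) \<le> cmod c * K" .
  then have "norm x' \<le> C * (cmod c * K)"
    using C(2)[OF x'] C(1) by (meson mult_left_mono order_trans)
  moreover have "norm x \<le> norm x' + cmod c"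
    using norm_triangle_ineq[of x' "scaleC_ell2 c ?e"] by (simp add: x'_def norm_scaleC norm_basis_vec)
  ultimately have nx: "norm x \<le> (1 + C * K) * cmod c" by (simp add: algebra_simps)
  have "1 = norm (Pn n (A x))" by (simp add: x(2) norm_basis_vec)
  also have "\<dots> \<le> norm (A x)" by (simp add: Pn_def norm_proj_on_le)
  also have "\<dots> \<le> K * norm x" by (rule K(2)[OF xZ])
  also have "\<dots> \<le> K * ((1 + C * K) * cmod c)" using nx K(1) by simp
  finally show ?thesis by (simp add: c_def mult.assoc)
qed

section \<open>Limit operators of an operator with stable finite sections\<close>

lemma shift_in_bounded_ops: "shift j \<in> bounded_ops UNIV"
  by (rule bounded_opsI[of _ _ 1]) (auto simp: norm_shift intro!: ell2_eqI simp: coord_simps)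

lemma shift_shift: "shift i (shift j x) = shift (i + j) x"
  by (rule ell2_eqI) (simp add: coord_simps algebra_simps)

lemma shift_zero: "shift 0 x = x"
  by (rule ell2_eqI) (simp add: coord_simps)

lemma shift_ell2_on_iff: "shift j x \<in> ell2_on {a..<b} \<longleftrightarrow> x \<in> ell2_on {a - j..<b - j}"
proof
  assume l: "shift j x \<in> ell2_on {a..<b}"
  have "coord x k = 0" if "k \<notin> {a - j..<b - j}" for k
    using l that unfolding ell2_on_def by (auto simp: coord_simps dest: spec[of _ "k + j"])
  then show "x \<in> ell2_on {a - j..<b - j}" by (simp add: ell2_on_def)
next
  assume "x \<in> ell2_on {a - j..<b - j}"
  then show "shift j x \<in> ell2_on {a..<b}" by (auto simp: ell2_on_def coord_simps)
qed

lemma proj_on_shift: "proj_on {a..<b} (shift j x) = shift j (proj_on {a - j..<b - j} x)"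
  by (rule ell2_eqI) (auto simp: coord_simps)

lemma comp_in_bounded_ops:
  assumes S: "S \<in> bounded_ops I" and T: "T \<in> bounded_ops I"
  shows "S \<circ> T \<in> bounded_ops I"
proof -
  obtain K L where K: "0 < K" "\<And>x. x \<in> ell2_on I \<Longrightarrow> norm (S x) \<le> K * norm x"
    and L: "\<And>x. x \<in> ell2_on I \<Longrightarrow> norm (T x) \<le> L * norm x"
    using bounded_ops_bound[OF S] bounded_ops_bound[OF T] by metis
  have "norm (S (T x)) \<le> K * L * norm x" if "x \<in> ell2_on I" for x
    using order_trans[OF K(2)[OF bounded_ops_in[OF T that]] mult_left_mono[OF L[OF that], of K]] K(1)
    by (simp add: mult.assoc)
  then show ?thesis
    using bounded_ops_in[OF T] bounded_ops_in[OF S]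
    by (intro bounded_opsI[of _ _ "K * L"])
      (simp_all add: bounded_ops_add[OF T] bounded_ops_add[OF S]
        bounded_ops_scaleC[OF T] bounded_ops_scaleC[OF S])
qed

lemma Q_eq_proj_on: "Q = proj_on {..<0}"
  by (rule ext, rule ell2_eqI) (auto simp: Q_def P_def coord_diff coord_simps)

lemma flip_flip: "flip (flip x) = x"
  by (rule ell2_eqI) (simp add: coord_simps)

lemma flip_ell2_on:
  "x \<in> ell2_on Zplus \<Longrightarrow> flip x \<in> ell2_on {..<0}"
  "x \<in> ell2_on {..<0} \<Longrightarrow> flip x \<in> ell2_on Zplus"
  by (auto simp: ell2_on_def coord_simps)

lemma JQBQJ_flip:
  assumes "x \<in> ell2_on {..<0}"
  shows "JQBQJ B (flip x) = flip (proj_on {..<0} (B x))"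
  using assms by (simp add: JQBQJ_def flip_flip Q_eq_proj_on proj_on_id)

lemma flip_in_bounded_ops: "flip \<in> bounded_ops UNIV"
  by (rule bounded_opsI[of _ _ 1]) (auto simp: norm_flip intro!: ell2_eqI simp: coord_simps)

lemma proj_on_in_bounded_ops: "proj_on I \<in> bounded_ops UNIV"
  by (rule bounded_opsI[of _ _ 1]) (auto simp: norm_proj_on_le proj_on_add proj_on_scaleC)

lemma JQBQJ_in_bounded_ops:
  assumes "B \<in> bounded_ops UNIV"
  shows "JQBQJ B \<in> bounded_ops Zplus"
proof -
  have "JQBQJ B \<in> bounded_ops UNIV"
    unfolding JQBQJ_def Q_eq_proj_on
    by (intro comp_in_bounded_ops assms flip_in_bounded_ops proj_on_in_bounded_ops)
  moreover have "JQBQJ B x \<in> ell2_on Zplus" for x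
    by (simp add: JQBQJ_def Q_eq_proj_on flip_ell2_on proj_on_in_ell2_on)
  ultimately show ?thesis by (auto simp: bounded_ops_def)
qed

text \<open>A sequence tending to infinity may repeat values or step back, whereas partial limits
  require increasing indices; positions and values are made increasing together.\<close>

lemma strict_mono_subseq:
  fixes f :: "nat \<Rightarrow> nat"
  assumes "filterlim f at_top sequentially"
  obtains r :: "nat \<Rightarrow> nat" where "strict_mono r" "strict_mono (f \<circ> r)"
proof -
  have "\<exists>r. \<forall>n. True \<and> r n < r (Suc n) \<and> f (r n) < f (r (Suc n))"
  proof (rule dependent_nat_choice)
    fix m n :: nat
    have "\<forall>\<^sub>F k in sequentially. f m < f k \<and> m < k"
      by (intro eventually_conj eventually_gt_at_top
          eventually_compose_filterlim[OF eventually_gt_at_top assms])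
    then show "\<exists>k. True \<and> m < k \<and> f m < f k"
      using eventually_happens'[OF sequentially_bot] by blast
  qed simp
  then obtain r where "\<forall>n :: nat. r n < r (Suc n) \<and> f (r n) < f (r (Suc n))" by auto
  then show ?thesis by (intro that[of r]) (simp_all add: strict_mono_Suc_iff)
qed

section \<open>Corner entries of the inverse sections and determinant quotients\<close>

locale stable_sections_op =
  fixes A :: "ell2 \<Rightarrow> ell2"
  assumes A: "A \<in> bounded_ops Zplus"
    and stable: "stable_sections A"
begin

lemma stable_bound:
  obtains C where "0 < C"
    "\<forall>\<^sub>F n in sequentially. invertible_on {0..<int n} (Pn n \<circ> A \<circ> Pn n) \<and>
      (\<forall>x\<in>ell2_on {0..<int n}. norm x \<le> C * norm ((Pn n \<circ> A \<circ> Pn n) x))"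
proof -
  obtain C where C: "\<forall>\<^sub>F n in sequentially. invertible_on {0..<int n} (Pn n \<circ> A \<circ> Pn n) \<and>
      (\<forall>x\<in>ell2_on {0..<int n}. norm (inverse_on {0..<int n} (Pn n \<circ> A \<circ> Pn n) x) \<le> C * norm x)"
    using stable unfolding stable_sections_def by blast
  \<comment> \<open>The bound on the inverse, evaluated at the image of \<open>x\<close>, becomes a
    lower estimate; the maximum with 1 makes the constant positive.\<close>
  have "\<forall>\<^sub>F n in sequentially. invertible_on {0..<int n} (Pn n \<circ> A \<circ> Pn n) \<and>
      (\<forall>x\<in>ell2_on {0..<int n}. norm x \<le> max C 1 * norm ((Pn n \<circ> A \<circ> Pn n) x))"
    using C
  proof eventually_elim
    case (elim n)
    let ?T = "Pn n \<circ> A \<circ> Pn n"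
    have "norm x \<le> max C 1 * norm (?T x)" if x: "x \<in> ell2_on {0..<int n}" for x
    proof -
      have "?T x \<in> ell2_on {0..<int n}" by (simp add: Pn_def proj_on_in_ell2_on)
      then have "norm (inverse_on {0..<int n} ?T (?T x)) \<le> C * norm (?T x)" using elim by blast
      then have "norm x \<le> C * norm (?T x)" using elim x by (simp only: inverse_on_left)
      also have "\<dots> \<le> max C 1 * norm (?T x)" by (rule mult_right_mono) simp_all
      finally show ?thesis .
    qed
    then show ?case using elim by blast
  qed
  then show ?thesis by (rule that[rotated]) simp
qed

text \<open>The last column of the inverse of the \<open>n\<close>-th section, an arbitrary vector
  at the finitely many \<open>n\<close> where no solution need exist. Its coordinate at
  \<open>int n - 1\<close> is the corner entry.\<close>

definition solution :: "nat \<Rightarrow> ell2" where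
  "solution n = (SOME x. x \<in> ell2_on {0..<int n}
     \<and> (Pn n \<circ> A \<circ> Pn n) x = basis_vec (int n - 1))"

lemma solution:
  assumes "0 < n" "invertible_on {0..<int n} (Pn n \<circ> A \<circ> Pn n)"
  shows "solution n \<in> ell2_on {0..<int n}"
    "(Pn n \<circ> A \<circ> Pn n) (solution n) = basis_vec (int n - 1)"
proof -
  have "basis_vec (int n - 1) \<in> ell2_on {0..<int n}"
    using assms(1) by (auto simp: ell2_on_def coord_simps)
  then obtain x where "x \<in> ell2_on {0..<int n}" "(Pn n \<circ> A \<circ> Pn n) x = basis_vec (int n - 1)"
    by (rule invertible_on_surj[OF assms(2)])
  then have "solution n \<in> ell2_on {0..<int n}
     \<and> (Pn n \<circ> A \<circ> Pn n) (solution n) = basis_vec (int n - 1)"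
    unfolding solution_def by - (rule someI[of _ x], blast)
  then show "solution n \<in> ell2_on {0..<int n}"
    "(Pn n \<circ> A \<circ> Pn n) (solution n) = basis_vec (int n - 1)" by blast+
qed

lemma det_ratio_eq:
  "\<forall>\<^sub>F n in sequentially. det_ratio A n = 1 / coord (solution n) (int n - 1)"
proof -
  obtain C where C: "0 < C" "\<forall>\<^sub>F n in sequentially. invertible_on {0..<int n} (Pn n \<circ> A \<circ> Pn n) \<and>
      (\<forall>x\<in>ell2_on {0..<int n}. norm x \<le> C * norm ((Pn n \<circ> A \<circ> Pn n) x))"
    by (rule stable_bound)
  show ?thesis
    using C(2) eventually_gt_at_top[of 0]
  proof eventually_elim
    case (elim n)
    then have inv: "invertible_on {0..<int n} (Pn n \<circ> A \<circ> Pn n)" by blast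
    show ?case
      using det_section_mat_pred[OF elim(2) inv solution[OF elim(2) inv]] det_section_mat_nonzero[OF inv]
      by (simp add: det_ratio_def)
  qed
qed

lemma corner_bounded_below:
  obtains c where "0 < c" "\<forall>\<^sub>F n in sequentially. c \<le> cmod (coord (solution n) (int n - 1))"
proof -
  obtain C where C: "0 < C" "\<forall>\<^sub>F n in sequentially. invertible_on {0..<int n} (Pn n \<circ> A \<circ> Pn n) \<and>
      (\<forall>x\<in>ell2_on {0..<int n}. norm x \<le> C * norm ((Pn n \<circ> A \<circ> Pn n) x))"
    by (rule stable_bound)
  obtain K where K: "0 < K" "\<And>x. x \<in> ell2_on Zplus \<Longrightarrow> norm (A x) \<le> K * norm x"
    using bounded_ops_bound[OF A] by blast
  \<comment> \<open>The corner estimate at size \<open>n\<close> uses stability of the section of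
    size \<open>n - 1\<close>.\<close>
  have C': "\<forall>\<^sub>F n in sequentially. \<forall>x\<in>ell2_on {0..<int (n - 1)}.
      norm x \<le> C * norm ((Pn (n - 1) \<circ> A \<circ> Pn (n - 1)) x)"
  proof -
    have "filterlim (\<lambda>n :: nat. n - 1) sequentially sequentially"
      by (rule filterlim_minus_const_nat_at_top)
    from eventually_compose_filterlim[OF C(2) this] show ?thesis by eventually_elim blast
  qed
  define c where "c = 1 / (K * (1 + C * K))"
  have pos: "0 < K * (1 + C * K)" using C(1) K(1) by (simp add: add_pos_pos)
  have "\<forall>\<^sub>F n in sequentially. c \<le> cmod (coord (solution n) (int n - 1))"
    using C(2) C' eventually_gt_at_top[of 0]
  proof eventually_elim
    case (elim n)
    have sol: "solution n \<in> ell2_on {0..<int n}"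
      "(Pn n \<circ> A \<circ> Pn n) (solution n) = basis_vec (int n - 1)"
      using solution[of n] elim by blast+
    have "1 \<le> K * (1 + C * K) * cmod (coord (solution n) (int n - 1))"
    proof (rule corner_lower_bound[OF elim(3) A K])
      show "norm x \<le> C * norm (Pn (n - 1) (A x))" if "x \<in> ell2_on {0..<int (n - 1)}" for x
        using elim(2) that by (fastforce simp: Pn_def proj_on_id)
      show "Pn n (A (solution n)) = basis_vec (int n - 1)"
        using sol by (simp add: Pn_def proj_on_id)
    qed (use C(1) sol(1) in simp_all)
    then show ?case using pos by (simp add: c_def field_simps)
  qed
  with pos show ?thesis by (intro that[of c]) (simp_all add: c_def)
qed

lemma limit_op_det_ratio:
  assumes T: "extend_op A \<in> bounded_ops UNIV"
    and h: "filterlim h at_top sequentially"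
    and B: "is_limit_op (extend_op A) h B"
  shows "invertible_on Zplus (JQBQJ B)"
    and "(\<lambda>k. coord (solution (nat (h k))) (h k - 1)) \<longlonglongrightarrow> inv_corner B"
    and "inv_corner B \<noteq> 0"
    and "(\<lambda>k. det_ratio A (nat (h k))) \<longlonglongrightarrow> G B"
proof -
  obtain C where C: "0 < C" "\<forall>\<^sub>F n in sequentially. invertible_on {0..<int n} (Pn n \<circ> A \<circ> Pn n) \<and>
      (\<forall>x\<in>ell2_on {0..<int n}. norm x \<le> C * norm ((Pn n \<circ> A \<circ> Pn n) x))"
    by (rule stable_bound)
  obtain K where K: "0 < K" "\<And>x. norm (extend_op A x) \<le> K * norm x"
    using bounded_ops_bound[OF T] by auto
  have nat_h: "filterlim (\<lambda>k. nat (h k)) sequentially sequentially"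
    using h by (rule filterlim_compose[OF filterlim_nat_sequentially])
  have h_pos: "\<forall>\<^sub>F k in sequentially. 0 < h k"
    by (rule eventually_compose_filterlim[OF eventually_gt_at_top h])
  define Tk where "Tk k = shift (- h k) \<circ> extend_op A \<circ> shift (h k)" for k
  define I where "I k = {- h k..<0}" for k
  have B_op: "B \<in> bounded_ops UNIV" using B by (simp add: is_limit_op_def)
  \<comment> \<open>Translation turns compression to \<open>I k\<close> into the section of size
    \<open>nat (h k)\<close>, so stability transfers with the same constant
    \<open>C\<close>.\<close>
  have compression: "proj_on (I k) (Tk k x)
      = shift (- h k) ((Pn (nat (h k)) \<circ> A \<circ> Pn (nat (h k))) (shift (h k) x))"
    if "0 < h k" "x \<in> ell2_on (I k)" for k x
  proof -
    have "shift (h k) x \<in> ell2_on {0..<int (nat (h k))}"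
      using that by (simp add: I_def shift_ell2_on_iff)
    from Pn_extend_op[OF this] show ?thesis
      using that by (simp add: I_def Tk_def proj_on_shift Pn_def)
  qed
  have ev: "\<forall>\<^sub>F k in sequentially. 0 < h k \<and>
      invertible_on {0..<int (nat (h k))} (Pn (nat (h k)) \<circ> A \<circ> Pn (nat (h k))) \<and>
      (\<forall>x\<in>ell2_on {0..<int (nat (h k))}.
        norm x \<le> C * norm ((Pn (nat (h k)) \<circ> A \<circ> Pn (nat (h k))) x))"
    using eventually_compose_filterlim[OF C(2) nat_h] h_pos by eventually_elim blast
  interpret stable_compressions Tk B I "{..<0}" K C
  proof
    show "Tk k \<in> bounded_ops UNIV" for k
      unfolding Tk_def by (intro comp_in_bounded_ops shift_in_bounded_ops T)
    show "norm (Tk k x) \<le> K * norm x" for k x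
      using K(2)[of "shift (h k) x"] by (simp add: Tk_def norm_shift)
    show "B \<in> bounded_ops UNIV" by (rule B_op)
    show "(\<lambda>k. Tk k x) \<longlonglongrightarrow> B x" "(\<lambda>k. adj (Tk k) x) \<longlonglongrightarrow> adj B x" for x
      using B by (simp_all add: is_limit_op_def Tk_def)
    show "I k \<subseteq> {..<0}" for k by (auto simp: I_def)
    show "\<forall>\<^sub>F k in sequentially. (j \<in> I k) = (j \<in> {..<0})" for j
    proof -
      have "\<forall>\<^sub>F k in sequentially. - j \<le> h k" using h by (simp add: filterlim_at_top)
      then show ?thesis by eventually_elim (auto simp: I_def)
    qed
    show "\<forall>\<^sub>F k in sequentially. \<forall>x\<in>ell2_on (I k). norm x \<le> C * norm (proj_on (I k) (Tk k x))"
      using ev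
    proof eventually_elim
      case (elim k)
      show ?case
      proof
        fix x assume x: "x \<in> ell2_on (I k)"
        then have "shift (h k) x \<in> ell2_on {0..<int (nat (h k))}"
          using elim by (simp add: I_def shift_ell2_on_iff)
        then have "norm (shift (h k) x)
            \<le> C * norm ((Pn (nat (h k)) \<circ> A \<circ> Pn (nat (h k))) (shift (h k) x))"
          using elim by blast
        then show "norm x \<le> C * norm (proj_on (I k) (Tk k x))"
          using compression[of k x] elim x by (simp add: norm_shift)
      qed
    qed
    show "\<forall>\<^sub>F k in sequentially. \<forall>y\<in>ell2_on (I k). \<exists>x\<in>ell2_on (I k). proj_on (I k) (Tk k x) = y"
      using ev
    proof eventually_elim
      case (elim k)
      show ?case
      proof
        fix y assume y: "y \<in> ell2_on (I k)"
        then have "shift (h k) y \<in> ell2_on {0..<int (nat (h k))}"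
          using elim by (simp add: I_def shift_ell2_on_iff)
        moreover have "invertible_on {0..<int (nat (h k))} (Pn (nat (h k)) \<circ> A \<circ> Pn (nat (h k)))"
          using elim by blast
        ultimately obtain z where z: "z \<in> ell2_on {0..<int (nat (h k))}"
          "(Pn (nat (h k)) \<circ> A \<circ> Pn (nat (h k))) z = shift (h k) y"
          using invertible_on_surj by blast
        define x where "x = shift (- h k) z"
        have x: "x \<in> ell2_on (I k)" "shift (h k) x = z"
          using z(1) elim by (simp_all add: x_def I_def shift_ell2_on_iff shift_shift shift_zero)
        have "proj_on (I k) (Tk k x) = y"
          using compression[OF _ x(1)] elim x(2) z(2) by (simp add: shift_shift shift_zero)
        with x(1) show "\<exists>x\<in>ell2_on (I k). proj_on (I k) (Tk k x) = y" by blast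
      qed
    qed
  qed
  show inv: "invertible_on Zplus (JQBQJ B)"
  proof (rule invertible_onI)
    show "JQBQJ B \<in> bounded_ops Zplus" by (rule JQBQJ_in_bounded_ops[OF B_op])
    show "norm x \<le> C * norm (JQBQJ B x)" if "x \<in> ell2_on Zplus" for x
      using limit_lower[OF flip_ell2_on(1)[OF that]] JQBQJ_flip[OF flip_ell2_on(1)[OF that], of B]
      by (simp add: flip_flip norm_flip)
    show "\<exists>x\<in>ell2_on Zplus. JQBQJ B x = y" if y: "y \<in> ell2_on Zplus" for y
    proof -
      obtain x where "x \<in> ell2_on {..<0}" "proj_on {..<0} (B x) = flip y"
        by (rule limit_surj[OF flip_ell2_on(1)[OF y]])
      then show ?thesis
        by (intro bexI[of _ "flip x"]) (simp_all add: JQBQJ_flip flip_flip flip_ell2_on)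
    qed
  qed
  have e1: "basis_vec (- 1) \<in> ell2_on {..<0}" by (auto simp: ell2_on_def coord_simps)
  obtain x where x: "x \<in> ell2_on {..<0}" "proj_on {..<0} (B x) = basis_vec (- 1)"
    by (rule limit_surj[OF e1])
  \<comment> \<open>The flip exchanges the basis vectors at -1 and 0, so the (0,0) entry of the
    inverse is read off at -1 from the solution \<open>x\<close> on the negative half-line.\<close>
  have corner: "inv_corner B = coord x (- 1)"
  proof -
    have "flip (basis_vec (- 1)) = basis_vec 0" by (rule ell2_eqI) (auto simp: coord_simps)
    then have "JQBQJ B (flip x) = basis_vec 0" using x by (simp add: JQBQJ_flip)
    then have "inverse_on Zplus (JQBQJ B) (basis_vec 0) = flip x"
      using inverse_on_left[OF inv flip_ell2_on(2)[OF x(1)]] by simp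
    moreover have "Pn 1 (basis_vec 0) = basis_vec 0"
      by (rule ell2_eqI) (auto simp: Pn_def coord_simps)
    ultimately show ?thesis by (simp add: inv_corner_def entry_def) (simp add: Pn_def coord_simps)
  qed
  define z where "z k = shift (- h k) (solution (nat (h k)))" for k
  have sol: "\<forall>\<^sub>F k in sequentially. z k \<in> ell2_on (I k) \<and> proj_on (I k) (Tk k (z k)) = basis_vec (- 1)"
    using ev
  proof eventually_elim
    case (elim k)
    have s: "solution (nat (h k)) \<in> ell2_on {0..<int (nat (h k))}"
      "(Pn (nat (h k)) \<circ> A \<circ> Pn (nat (h k))) (solution (nat (h k))) = basis_vec (h k - 1)"
      using solution[of "nat (h k)"] elim by auto
    have "z k \<in> ell2_on (I k)"
      using s(1) elim by (simp add: z_def I_def shift_ell2_on_iff)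
    moreover have "shift (- h k) (basis_vec (h k - 1)) = basis_vec (- 1)"
      by (rule ell2_eqI) (auto simp: coord_simps)
    ultimately show ?case
      using compression[of k "z k"] elim s(2) by (simp add: z_def shift_shift shift_zero)
  qed
  have "z \<longlonglongrightarrow> x"
  proof (rule solutions_tendsto[OF x(1)])
    show "\<forall>\<^sub>F k in sequentially. z k \<in> ell2_on (I k)" using sol by eventually_elim blast
    show "(\<lambda>k. proj_on (I k) (Tk k (z k))) \<longlonglongrightarrow> proj_on {..<0} (B x)"
      unfolding x(2) by (rule tendsto_eventually) (use sol in eventually_elim, blast)
  qed
  \<comment> \<open>After translation by \<open>- h k\<close>, coordinate -1 of \<open>z k\<close>
    is the last coordinate of the solution of the section of size \<open>h k\<close>.\<close>
  from tendsto_coord[OF this, of "- 1"]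
  show lim_corner: "(\<lambda>k. coord (solution (nat (h k))) (h k - 1)) \<longlonglongrightarrow> inv_corner B"
    by (simp add: z_def coord_simps corner)
  obtain c where c: "0 < c" "\<forall>\<^sub>F n in sequentially. c \<le> cmod (coord (solution n) (int n - 1))"
    by (rule corner_bounded_below)
  have "\<forall>\<^sub>F k in sequentially. c \<le> cmod (coord (solution (nat (h k))) (h k - 1))"
    using eventually_compose_filterlim[OF c(2) nat_h] h_pos by eventually_elim simp
  then have "c \<le> cmod (inv_corner B)"
    by (intro tendsto_lowerbound[OF tendsto_norm[OF lim_corner]]) simp_all
  then show nz: "inv_corner B \<noteq> 0" using c(1) by auto
  have "(\<lambda>k. 1 / coord (solution (nat (h k))) (h k - 1)) \<longlonglongrightarrow> G B"
    unfolding G_def by (intro tendsto_intros lim_corner nz)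
  moreover have "\<forall>\<^sub>F k in sequentially.
      1 / coord (solution (nat (h k))) (h k - 1) = det_ratio A (nat (h k))"
    using eventually_compose_filterlim[OF det_ratio_eq nat_h] h_pos by eventually_elim simp
  ultimately show "(\<lambda>k. det_ratio A (nat (h k))) \<longlonglongrightarrow> G B"
    by (rule Lim_transform_eventually)
qed

end

theorem theorem3p2:
  fixes A :: "ell2 \<Rightarrow> ell2"
  assumes "A \<in> L_dollar_Zplus"
    and "stable_sections A"
  shows "(\<forall>B \<in> sigma_plus (extend_op A). invertible_on Zplus (JQBQJ B) \<and> inv_corner B \<noteq> 0)
    \<and> partial_limits A = {G B | B. B \<in> sigma_plus (extend_op A)}"
proof -
  interpret stable_sections_op A
    using assms by unfold_locales (simp_all add: L_dollar_Zplus_def)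
  have L: "extend_op A \<in> L_dollar" using assms(1) by (simp add: L_dollar_Zplus_def)
  then have T: "extend_op A \<in> bounded_ops UNIV" by (simp add: L_dollar_def)
  note results = limit_op_det_ratio[OF T]
  have "invertible_on Zplus (JQBQJ B) \<and> inv_corner B \<noteq> 0" if "B \<in> sigma_plus (extend_op A)" for B
    using that results unfolding sigma_plus_def by blast
  moreover have "G B \<in> partial_limits A" if "B \<in> sigma_plus (extend_op A)" for B
  proof -
    obtain h where h: "filterlim h at_top sequentially" "is_limit_op (extend_op A) h B"
      using \<open>B \<in> sigma_plus (extend_op A)\<close> unfolding sigma_plus_def by blast
    have lim: "(\<lambda>k. det_ratio A (nat (h k))) \<longlonglongrightarrow> G B" by (rule results(4)[OF h])
    have "filterlim (\<lambda>k. nat (h k)) sequentially sequentially"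
      using h(1) by (rule filterlim_compose[OF filterlim_nat_sequentially])
    then obtain r :: "nat \<Rightarrow> nat" where r: "strict_mono r" "strict_mono ((\<lambda>k. nat (h k)) \<circ> r)"
      by (rule strict_mono_subseq)
    have "(\<lambda>k. det_ratio A (((\<lambda>k. nat (h k)) \<circ> r) k)) \<longlonglongrightarrow> G B"
      using LIMSEQ_subseq_LIMSEQ[OF lim r(1)] by (simp add: o_def)
    with r(2) show ?thesis unfolding partial_limits_def by blast
  qed
  \<comment> \<open>The section sizes \<open>r\<close> themselves serve as translation distances.
    Along a refinement with a limit operator \<open>B\<close> the quotients tend both to
    \<open>z\<close> and to \<open>G B\<close>.\<close>
  moreover have "\<exists>B. z = G B \<and> B \<in> sigma_plus (extend_op A)" if "z \<in> partial_limits A" for z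
  proof -
    obtain r :: "nat \<Rightarrow> nat" where r: "strict_mono r" and z: "(\<lambda>k. det_ratio A (r k)) \<longlonglongrightarrow> z"
      using \<open>z \<in> partial_limits A\<close> unfolding partial_limits_def by blast
    have int_r: "filterlim (\<lambda>k. int (r k)) at_top sequentially"
      by (rule filterlim_compose[OF filterlim_int_sequentially filterlim_subseq[OF r]])
    then have "filterlim (\<lambda>k. \<bar>int (r k)\<bar>) at_top sequentially" by simp
    from L[unfolded L_dollar_def mem_Collect_eq, THEN conjunct2, rule_format, OF this] obtain s :: "nat \<Rightarrow> nat" and B where s: "strict_mono s"
      and B: "is_limit_op (extend_op A) ((\<lambda>k. int (r k)) \<circ> s) B"
      by blast
    have rs: "filterlim ((\<lambda>k. int (r k)) \<circ> s) at_top sequentially"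
      using filterlim_compose[OF int_r filterlim_subseq[OF s]] by (simp add: o_def)
    have "(\<lambda>k. det_ratio A (r (s k))) \<longlonglongrightarrow> G B"
      using results(4)[OF rs B] by simp
    moreover have "(\<lambda>k. det_ratio A (r (s k))) \<longlonglongrightarrow> z"
      using LIMSEQ_subseq_LIMSEQ[OF z s] by (simp add: o_def)
    ultimately have "z = G B" by (rule LIMSEQ_unique[rotated])
    with rs B show ?thesis unfolding sigma_plus_def by blast
  qed
  ultimately show ?thesis by blast
qed

end
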